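(* Let $\Phi$ be a Young function which satisfies $$\Phi(x)=-x^2\log x,\qquad 0\le x\le e^{-2/3}$$ (with value $0$ at $x=0$). Then for every $p<2$ (with $p\geq 1$), $$M^p(\mathbb{Z}^n)\subseteq M^\Phi(\mathbb{Z}^n)\subseteq M^2(\mathbb{Z}^n),$$ with continuous and dense inclusions.
   Context: A Young function is a convex function $\Phi:[0,\infty]\to[0,\infty]$ with $\Phi(0)=0$ and $\lim_{t\to\infty}\Phi(t)=\Phi(\infty)=\infty$. $\mathcal{S}(\mathbb{Z}^n)$ is the space of $g:\mathbb{Z}^n\to\mathbb{C}$ such that for every $M<\infty$ there is $C_{g,M}$ with $|g(k)|\le C_{g,M}(1+|k|)^{-M}$ for all $k$, with topology given by the seminorms $\sup_k(1+|k|)^j|g(k)|$, $j\in\mathbb{N}_0$; $\mathcal{S}'(\mathbb{Z}^n)$ is the space of continuous linear functionals on it. For $g\in\mathcal{S}(\mathbb{Z}^n)$ and $f\in\mathcal{S}'(\mathbb{Z}^n)$, the short-time Fourier transform is $V_gf(m,w)=\sum_{k\in\mathbb{Z}^n}f(k)\overline{g(k-m)}e^{-2\pi i w\cdot k}$, $(m,w)\in\mathbb{Z}^n\times\mathbb{T}^n$. $L^\Phi(\mathbb{Z}^n\times\mathbb{T}^n)$ consists of the measurable $F$ with $\|F\|_{L^\Phi}=\inf\{b>0:\sum_{m\in\mathbb{Z}^n}\int_{\mathbb{T}^n}\Phi(|F(m,w)|/b)\,dw\le 1\}<\infty$. Fix a non-zero window $g\in\mathcal{S}(\mathbb{Z}^n)$.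 For $1\le p\le\infty$, $M^p(\mathbb{Z}^n)$ is the space of $f\in\mathcal{S}'(\mathbb{Z}^n)$ with $\|f\|_{M^p(\mathbb{Z}^n)}=\|V_gf\|_{L^p(\mathbb{Z}^n\times\mathbb{T}^n)}<\infty$; $M^\Phi(\mathbb{Z}^n)$ is the space of $f\in\mathcal{S}'(\mathbb{Z}^n)$ with $\|f\|_{M^\Phi(\mathbb{Z}^n)}=\|V_gf\|_{L^\Phi(\mathbb{Z}^n\times\mathbb{T}^n)}<\infty$. The spaces are independent of the choice of window.
   Formalization: As printed no Young function equals -x^2 log x on all of [0,e^{-2/3}] (convexity fails beyond e^{-3/2}); the formal statement assumes the formula only on [0,c] for an arbitrary 0<c≤e^{-2/3}, which includes the printed constant and the satisfiable c=e^{-3/2}. *)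

theory Defs
  imports "HOL-Analysis.Analysis"
begin

definition young_function :: "(ennreal \<Rightarrow> ennreal) \<Rightarrow> bool" where
  "young_function \<Phi> \<longleftrightarrow>
     (\<forall>x y. \<forall>t\<in>{0..1::real}.
        \<Phi> (ennreal t * x + ennreal (1 - t) * y) \<le> ennreal t * \<Phi> x + ennreal (1 - t) * \<Phi> y) \<and>
     \<Phi> 0 = 0 \<and>
     ((\<lambda>t::real. \<Phi> (ennreal t)) \<longlongrightarrow> \<infinity>) at_top \<and>
     \<Phi> \<infinity> = \<infinity>"

text \<open>The function \<open>- x\<^sup>2 log x\<close> has second derivative \<open>- 2 log x - 3\<close>, so it is convex on
  \<open>[0, c]\<close> only for \<open>c \<le> exp (-3/2)\<close>. No Young function agrees with it on the larger interval
  \<open>[0, exp (-2/3)]\<close>; statements about Young functions of this form should therefore admit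
  smaller \<open>c\<close>.\<close>

text \<open>The topology on \<open>X\<close> defined by a family \<open>N\<close> of seminorms; a singleton family gives the
  topology of a normed space.\<close>

definition seminorm_topology :: "'a::minus set \<Rightarrow> ('i \<Rightarrow> 'a \<Rightarrow> real) \<Rightarrow> 'a topology" where
  "seminorm_topology X N = topology (\<lambda>U. U \<subseteq> X \<and>
     (\<forall>x\<in>U. \<exists>J e. finite J \<and> 0 < e \<and> {y \<in> X. \<forall>j\<in>J. N j (y - x) < e} \<subseteq> U))"

lemma openin_seminorm_topology:
  "openin (seminorm_topology X N) U \<longleftrightarrow> U \<subseteq> X \<and>
     (\<forall>x\<in>U. \<exists>J e. finite J \<and> 0 < e \<and> {y \<in> X. \<forall>j\<in>J. N j (y - x) < e} \<subseteq> U)"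
proof -
  let ?P = "\<lambda>U. U \<subseteq> X \<and>
     (\<forall>x\<in>U. \<exists>J e. finite J \<and> 0 < e \<and> {y \<in> X. \<forall>j\<in>J. N j (y - x) < e} \<subseteq> U)"
  have "istopology ?P"
    unfolding istopology_def
  proof (intro conjI allI impI)
    fix S T assume S: "?P S" and T: "?P T"
    show "S \<inter> T \<subseteq> X" using S by blast
    show "\<forall>x\<in>S \<inter> T. \<exists>J e. finite J \<and> 0 < e \<and> {y \<in> X. \<forall>j\<in>J. N j (y - x) < e} \<subseteq> S \<inter> T"
    proof
      fix x assume "x \<in> S \<inter> T"
      then have "x \<in> S" "x \<in> T" by auto
      obtain J d where J: "finite J" "0 < d" "{y \<in> X. \<forall>j\<in>J. N j (y - x) < d} \<subseteq> S"
        using bspec[OF conjunct2[OF S] \<open>x \<in> S\<close>] by (elim exE conjE)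
      obtain K e where K: "finite K" "0 < e" "{y \<in> X. \<forall>j\<in>K. N j (y - x) < e} \<subseteq> T"
        using bspec[OF conjunct2[OF T] \<open>x \<in> T\<close>] by (elim exE conjE)
      from J K have "finite (J \<union> K) \<and> 0 < min d e \<and>
          {y \<in> X. \<forall>j\<in>J \<union> K. N j (y - x) < min d e} \<subseteq> S \<inter> T"
        by auto
      then show "\<exists>J e. finite J \<and> 0 < e \<and> {y \<in> X. \<forall>j\<in>J. N j (y - x) < e} \<subseteq> S \<inter> T"
        by blast
    qed
  next
    fix \<K> assume K: "\<forall>S\<in>\<K>. ?P S"
    show "\<Union>\<K> \<subseteq> X" using K by blast
    show "\<forall>x\<in>\<Union>\<K>. \<exists>J e. finite J \<and> 0 < e \<and> {y \<in> X. \<forall>j\<in>J. N j (y - x) < e} \<subseteq> \<Union>\<K>"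
    proof
      fix x assume "x \<in> \<Union>\<K>"
      then obtain S where S: "S \<in> \<K>" "x \<in> S" by blast
      obtain J e where "finite J" "0 < e" "{y \<in> X. \<forall>j\<in>J. N j (y - x) < e} \<subseteq> S"
        using bspec[OF conjunct2[OF bspec[OF K S(1)]] S(2)] by (elim exE conjE)
      then show "\<exists>J e. finite J \<and> 0 < e \<and> {y \<in> X. \<forall>j\<in>J. N j (y - x) < e} \<subseteq> \<Union>\<K>"
        using S(1) by (intro exI[of _ J] exI[of _ e]) blast
    qed
  qed
  then show ?thesis
    by (simp add: seminorm_topology_def topology_inverse')
qed

lemma topspace_seminorm_topology [simp]: "topspace (seminorm_topology X N) = X"
proof
  show "topspace (seminorm_topology X N) \<subseteq> X"
    using openin_topspace[of "seminorm_topology X N"] unfolding openin_seminorm_topology by blast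
  have "openin (seminorm_topology X N) X"
    unfolding openin_seminorm_topology by (auto intro!: exI[of _ "{}"] exI[of _ "1::real"])
  then show "X \<subseteq> topspace (seminorm_topology X N)"
    by (rule openin_subset)
qed

definition zvec :: "int ^ 'n \<Rightarrow> real ^ 'n" where
  "zvec k = (\<chi> i. real_of_int (k $ i))"

definition schwartz :: "(int ^ 'n \<Rightarrow> complex) set" where
  "schwartz = {g. \<forall>M::real. \<exists>C. \<forall>k. cmod (g k) \<le> C * (1 + norm (zvec k)) powr (- M)}"

definition schwartz_seminorm :: "nat \<Rightarrow> (int ^ 'n \<Rightarrow> complex) \<Rightarrow> real" where
  "schwartz_seminorm j g = (SUP k. (1 + norm (zvec k)) ^ j * cmod (g k))"

definition schwartz_topology :: "(int ^ 'n \<Rightarrow> complex) topology" where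
  "schwartz_topology = seminorm_topology schwartz schwartz_seminorm"

text \<open>Functionals on the Schwartz space are total functions in HOL; requiring the value \<open>0\<close> off
  that space makes each of them a unique object, and this choice is stable under subtraction.\<close>

definition schwartz_dual :: "((int ^ 'n \<Rightarrow> complex) \<Rightarrow> complex) set" where
  "schwartz_dual = {f.
     (\<forall>\<phi>. \<phi> \<notin> schwartz \<longrightarrow> f \<phi> = 0) \<and>
     (\<forall>\<phi>\<in>schwartz. \<forall>\<psi>\<in>schwartz. \<forall>a b. f (\<lambda>k. a * \<phi> k + b * \<psi> k) = a * f \<phi> + b * f \<psi>) \<and>
     continuous_map schwartz_topology euclidean f}"

text \<open>A functional \<open>f\<close> is identified with the sequence of its values \<open>f(k)\<close> at the unit
  sequences, so that \<open>f(\<phi>) = \<Sum>\<^sub>k f(k) \<phi>(k)\<close>.\<close>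

definition coef :: "((int ^ 'n \<Rightarrow> complex) \<Rightarrow> complex) \<Rightarrow> int ^ 'n \<Rightarrow> complex" where
  "coef f k = f (\<lambda>l. if l = k then 1 else 0)"

definition stft :: "(int ^ 'n \<Rightarrow> complex) \<Rightarrow> ((int ^ 'n \<Rightarrow> complex) \<Rightarrow> complex) \<Rightarrow>
    (int ^ 'n) \<times> (real ^ 'n) \<Rightarrow> complex" where
  "stft g f = (\<lambda>(m, w). \<Sum>\<^sub>\<infinity>k. coef f k * cnj (g (k - m)) *
     exp (- (2 * complex_of_real pi * \<i> * complex_of_real (w \<bullet> zvec k))))"

text \<open>The torus is represented by its fundamental domain, the half-open unit cube.\<close>

definition torus :: "(real ^ 'n) set" where
  "torus = {w. \<forall>i. 0 \<le> w $ i \<and> w $ i < 1}"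

definition phase_integral :: "((int ^ 'n) \<times> (real ^ 'n) \<Rightarrow> ennreal) \<Rightarrow> ennreal" where
  "phase_integral H = (\<integral>\<^sup>+m. (\<integral>\<^sup>+w. H (m, w) \<partial>lebesgue_on torus) \<partial>count_space UNIV)"

definition Lp_norm :: "real \<Rightarrow> ((int ^ 'n) \<times> (real ^ 'n) \<Rightarrow> complex) \<Rightarrow> ennreal" where
  "Lp_norm p F = (let I = phase_integral (\<lambda>z. ennreal (cmod (F z) powr p)) in
     if I = \<infinity> then \<infinity> else ennreal (enn2real I powr (1 / p)))"

definition orlicz_norm ::
    "(ennreal \<Rightarrow> ennreal) \<Rightarrow> ((int ^ 'n) \<times> (real ^ 'n) \<Rightarrow> complex) \<Rightarrow> ennreal" where
  "orlicz_norm \<Phi> F =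
     Inf {ennreal b | b. 0 < b \<and> phase_integral (\<lambda>z. \<Phi> (ennreal (cmod (F z) / b))) \<le> 1}"

text \<open>The parameter \<open>N\<close> is the norm of the function space on phase space: \<open>Lp_norm p\<close> yields
  \<open>M\<^sup>p\<close> and \<open>orlicz_norm \<Phi>\<close> yields \<open>M\<^sup>\<Phi>\<close>. No measurability condition is needed, as the
  short-time Fourier transform of an element of the dual is continuous in its second argument.\<close>

definition modulation_space ::
    "(((int ^ 'n) \<times> (real ^ 'n) \<Rightarrow> complex) \<Rightarrow> ennreal) \<Rightarrow> (int ^ 'n \<Rightarrow> complex) \<Rightarrow>
     ((int ^ 'n \<Rightarrow> complex) \<Rightarrow> complex) set" where
  "modulation_space N g = {f \<in> schwartz_dual. N (stft g f) < \<infinity>}"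

definition modulation_topology ::
    "(((int ^ 'n) \<times> (real ^ 'n) \<Rightarrow> complex) \<Rightarrow> ennreal) \<Rightarrow> (int ^ 'n \<Rightarrow> complex) \<Rightarrow>
     ((int ^ 'n \<Rightarrow> complex) \<Rightarrow> complex) topology" where
  "modulation_topology N g =
     seminorm_topology (modulation_space N g) (\<lambda>_::unit. \<lambda>f. enn2real (N (stft g f)))"

definition continuous_dense_inclusion :: "'a topology \<Rightarrow> 'a topology \<Rightarrow> bool" where
  "continuous_dense_inclusion X Y \<longleftrightarrow>
     topspace X \<subseteq> topspace Y \<and> continuous_map X Y id \<and> Y closure_of topspace X = topspace Y"

end

theory Submission
  imports Defs
begin

text \<open>Both inclusions are statements about coefficient sequences. By Fourier inversion on the torus,
  \<open>|f(k)| |g(k\<^sub>0)| \<le> \<integral> |V\<^sub>g f(k - k\<^sub>0, w)| dw\<close>, while \<open>|V\<^sub>g f(m, w)| \<le> \<Sum>\<^sub>k |f(k)| |g(k - m)|\<close>;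
  a Jensen inequality turns these averages into an equivalence of \<open>\<parallel>V\<^sub>g f\<parallel>\<close> with the norm of \<open>f\<close> in
  the Orlicz sequence space. Since the elements of a sequence space are bounded, only the behaviour
  of \<open>\<Phi>\<close> near \<open>0\<close> matters, where \<open>x\<^sup>2 \<le> \<Phi>(x) \<le> C x\<^sup>p\<close>. Since \<open>\<Phi>\<close> and \<open>x\<^sup>2\<close> are doubling near \<open>0\<close>,
  truncations of \<open>f\<close> to finite sets of coefficients are dense.\<close>

section \<open>Fourier coefficients on the torus\<close>

text \<open>Away from 0 almost nothing is known about \<Phi>, which may even jump to infinity. All
  estimates are therefore made for the class \<open>modular\<close>, which contains \<Phi> and every
  power x^p with p >= 1. Since the Lebesgue norm is the Luxemburg norm of x^p, both inclusions
  become instances of one lemma about two modulars.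

  Why a comparison on a small interval [0, x0] is enough: a modular at most 1 bounds all terms by
  one constant, and enlarging the scale by a factor K moves them all into [0, x0]. A constant in the
  comparison is absorbed the same way, since \<Phi>(x / K) <= \<Phi>(x) / K.

  For density the delicate point is the scale. Finite modular at one scale makes tails small at that
  scale, whereas approximation in norm asks for modular at most 1 at arbitrarily small scales.
  Doubling on [0, x0] bridges the gap; without it, truncations may fail to be dense in an Orlicz
  space.

  The condition p < 2 enters through \<open>x^2 |log x| <= x^p / (2 - p)\<close>, whose constant
  blows up as p tends to 2.\<close>

lemma integral_lborel_prod:
  fixes h :: "'a::euclidean_space \<Rightarrow> real \<Rightarrow> complex"
  assumes "\<And>b. b \<in> Basis \<Longrightarrow> integrable lborel (h b)"
  shows "(LINT x|lborel. (\<Prod>b\<in>Basis. h b (x \<bullet> b))) = (\<Prod>b\<in>Basis. (LINT x|lborel. h b x))"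
proof -
  interpret product_sigma_finite "\<lambda>_::'a. lborel :: real measure" ..
  have [measurable]: "h b \<in> borel_measurable borel" if "b \<in> Basis" for b
    using borel_measurable_integrable[OF assms[OF that]] by simp
  have "(LINT x|lborel. (\<Prod>b\<in>Basis. h b (x \<bullet> b)))
      = (LINT f|(\<Pi>\<^sub>M b\<in>(Basis::'a set). lborel). (\<Prod>b\<in>Basis. h b (f b)))"
    by (subst lborel_eq, subst integral_distr) (simp_all cong: prod.cong)
  also have "\<dots> = (\<Prod>b\<in>Basis. (LINT x|lborel. h b x))"
    by (rule product_integral_prod) (auto intro: assms)
  finally show ?thesis .
qed

lemma integral_exp_unit_interval:
  fixes j :: int
  shows "integrable lborel (\<lambda>x. indicator {0..<1} x *\<^sub>R exp (2 * of_real pi * \<i> * of_real (x * of_int j)))"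
    and "(LINT x|lborel. indicator {0..<1} x *\<^sub>R exp (2 * of_real pi * \<i> * of_real (x * of_int j))) =
      (if j = 0 then 1 else 0)"
proof -
  define e where "e x = exp (2 * of_real pi * \<i> * of_real (x * of_int j) :: complex)" for x :: real
  \<comment> \<open>The fundamental theorem of calculus is applied on the closed interval, while the
    torus is half-open; the two differ by the null set containing only 1.\<close>
  have ae: "AE x in lborel. indicator {0..1} x *\<^sub>R e x = indicator {0..<1::real} x *\<^sub>R e x"
    using AE_lborel_singleton[of 1] by eventually_elim (auto simp: indicator_def)
  have [measurable]: "e \<in> borel_measurable borel"
    unfolding e_def by measurable
  have "continuous_on {0..1} e" unfolding e_def by (intro continuous_intros)
  then have "integrable lborel (\<lambda>x. indicator {0..1} x *\<^sub>R e x)"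
    using borel_integrable_atLeastAtMost'[of 0 1 e] unfolding set_integrable_def by simp
  then show "integrable lborel (\<lambda>x. indicator {0..<1} x *\<^sub>R exp (2 * of_real pi * \<i> * of_real (x * of_int j)))"
    unfolding e_def[symmetric] by (subst integrable_cong_AE[symmetric, OF _ _ ae]) auto
  have "(LINT x|lborel. indicator {0..1} x *\<^sub>R e x) = (if j = 0 then 1 else 0)"
  proof (cases "j = 0")
    case True
    then show ?thesis by (simp add: e_def)
  next
    case False
    have "(LINT x|lborel. indicator {0..1} x *\<^sub>R e x) =
        e 1 / (2 * of_real pi * \<i> * of_int j) - e 0 / (2 * of_real pi * \<i> * of_int j)"
    proof (rule integral_FTC_atLeastAtMost)
      have "((\<lambda>z. exp (2 * of_real pi * \<i> * (z * of_int j)) / (2 * of_real pi * \<i> * of_int j))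
          has_field_derivative e x) (at (of_real x))" for x
        unfolding e_def using False by (auto intro!: derivative_eq_intros)
      then show "((\<lambda>x. e x / (2 * of_real pi * \<i> * of_int j)) has_vector_derivative e x) (at x within {0..1})" for x
        using has_vector_derivative_real_field by (force simp: e_def)
      show "continuous_on {0..1} e" unfolding e_def by (intro continuous_intros)
    qed simp
    moreover have "e 1 = 1"
      using exp_2pi_1_int[of j] by (simp add: e_def mult_ac)
    ultimately show ?thesis using False by (simp add: e_def)
  qed
  then show "(LINT x|lborel. indicator {0..<1} x *\<^sub>R exp (2 * of_real pi * \<i> * of_real (x * of_int j))) =
      (if j = 0 then 1 else 0)"
    unfolding e_def[symmetric] by (subst integral_cong_AE[symmetric, OF _ _ ae]) auto
qed

lemma torus_borel [measurable]: "(torus :: (real^'n) set) \<in> sets borel"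
proof -
  have "torus = (\<Inter>i. {w :: real^'n. 0 \<le> w $ i \<and> w $ i < 1})"
    by (auto simp: torus_def)
  also have "\<dots> \<in> sets borel"
    by (intro sets.finite_INT) auto
  finally show ?thesis .
qed

text \<open>The product form lets integrals over the torus factor into one-dimensional ones.\<close>

lemma indicator_torus: "indicator torus w = (\<Prod>b\<in>Basis. indicator {0..<1} ((w :: real^'n) \<bullet> b) :: real)"
proof -
  have "w \<in> torus \<longleftrightarrow> (\<forall>b\<in>Basis. w \<bullet> b \<in> {0..<1})"
    by (auto simp: torus_def Basis_vec_def cart_eq_inner_axis)
  then show ?thesis
    by (auto simp: indicator_def)
qed

lemma integral_torus_eq_lborel:
  fixes f :: "real^'n \<Rightarrow> complex"
  assumes "f \<in> borel_measurable borel"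
  shows "(LINT w|lebesgue_on torus. f w) = (LINT w|lborel. indicator torus w *\<^sub>R f w)"
  using assms by (subst integral_restrict_space) (auto intro!: integral_completion sets_completionI_sets)

lemma emeasure_torus: "emeasure lebesgue (torus :: (real^'n) set) = 1"
proof -
  have "emeasure lebesgue (torus :: (real^'n) set) = (\<integral>\<^sup>+w. indicator (torus :: (real^'n) set) w \<partial>lborel)"
    by (simp add: nn_integral_indicator)
  also have "\<dots> = (\<integral>\<^sup>+w. (\<Prod>b\<in>Basis. indicator {0..<1} ((w::real^'n) \<bullet> b)) \<partial>lborel)"
    by (intro nn_integral_cong) (simp add: indicator_torus flip: ennreal_indicator prod_ennreal)
  also have "\<dots> = 1"
    by (subst nn_integral_lborel_prod[where f = "\<lambda>b. indicator {0..<1}"]) auto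
  finally show ?thesis .
qed

lemma emeasure_lebesgue_on_torus: "emeasure (lebesgue_on torus) (torus :: (real^'n) set) = 1"
  by (subst emeasure_restrict_space) (auto simp: emeasure_torus sets_completionI_sets)

lemma integral_exp_torus:
  fixes l :: "int^'n"
  shows "(LINT w|lebesgue_on torus. exp (2 * of_real pi * \<i> * of_real (w \<bullet> zvec l))) = (if l = 0 then 1 else (0::complex))"
proof -
  \<comment> \<open>The coordinates of \<open>l\<close> are indexed here by basis vectors, as the
    product formula requires. The floor only turns the inner product, which is integer-valued on
    \<open>Basis\<close>, into an \<open>int\<close>.\<close>
  define n :: "real^'n \<Rightarrow> int" where "n b = \<lfloor>b \<bullet> zvec l\<rfloor>" for b
  have n: "of_int (n b) = b \<bullet> zvec l" if "b \<in> Basis" for b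
    using that by (auto simp: n_def Basis_vec_def inner_axis' zvec_def)
  define h where "h b x = indicator {0..<1} x *\<^sub>R exp (2 * of_real pi * \<i> * of_real (x * of_int (n b)) :: complex)" for b x
  have "(LINT w|lebesgue_on torus. exp (2 * of_real pi * \<i> * of_real (w \<bullet> zvec l)))
      = (LINT w|lborel. indicator torus w *\<^sub>R exp (2 * of_real pi * \<i> * of_real (w \<bullet> zvec l)))"
    by (rule integral_torus_eq_lborel) measurable
  also have "\<dots> = (LINT w|lborel. (\<Prod>b\<in>Basis. h b (w \<bullet> b)))"
  proof (rule Bochner_Integration.integral_cong)
    fix w :: "real^'n"
    have "w \<bullet> zvec l = (\<Sum>b\<in>Basis. (w \<bullet> b) * of_int (n b))"
      by (subst euclidean_inner) (auto simp: n inner_commute intro!: sum.cong)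
    then have "exp (2 * of_real pi * \<i> * of_real (w \<bullet> zvec l)) =
        (\<Prod>b\<in>Basis. exp (2 * of_real pi * \<i> * of_real ((w \<bullet> b) * of_int (n b)) :: complex))"
      by (simp add: sum_distrib_left flip: exp_sum)
    then show "indicator torus w *\<^sub>R exp (2 * of_real pi * \<i> * of_real (w \<bullet> zvec l)) = (\<Prod>b\<in>Basis. h b (w \<bullet> b))"
      by (simp add: h_def indicator_torus scaleR_conv_of_real prod.distrib)
  qed simp
  also have "\<dots> = (\<Prod>b\<in>Basis. (LINT x|lborel. h b x))"
    by (rule integral_lborel_prod) (simp add: h_def integral_exp_unit_interval del: of_real_mult)
  also have "\<dots> = (\<Prod>b\<in>(Basis :: (real^'n) set). if n b = 0 then 1 else 0)"
    by (simp add: h_def integral_exp_unit_interval del: of_real_mult)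
  also have "\<dots> = (if \<forall>b\<in>(Basis :: (real^'n) set). n b = 0 then 1 else 0)"
    by auto
  also have "(\<forall>b\<in>(Basis :: (real^'n) set). n b = 0) \<longleftrightarrow> l = 0"
    by (auto simp: n_def Basis_vec_def inner_axis' zvec_def vec_eq_iff)
  finally show ?thesis .
qed

section \<open>Absolutely convergent trigonometric series\<close>

lemma zvec_diff: "zvec (k - l) = zvec k - zvec l"
  by (simp add: zvec_def vec_eq_iff)

text \<open>For fixed \<open>m\<close>, the short-time Fourier transform is such a series in
  \<open>w\<close>, with coefficients \<open>coef f k * cnj (g (k - m))\<close>.\<close>

definition expsum :: "(int ^ 'n \<Rightarrow> complex) \<Rightarrow> real ^ 'n \<Rightarrow> complex" where
  "expsum u w = (\<Sum>\<^sub>\<infinity>k. u k * exp (- (2 * complex_of_real pi * \<i> * complex_of_real (w \<bullet> zvec k))))"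

lemma norm_exp_char [simp]: "cmod (exp (- (2 * complex_of_real pi * \<i> * complex_of_real x))) = 1"
  "cmod (exp (2 * complex_of_real pi * \<i> * complex_of_real x)) = 1"
  by (simp_all add: norm_exp_eq_Re)

text \<open>By the Weierstrass test the approximation is uniform in \<open>w\<close>. Asking for
  \<open>k \<in> S\<close> ensures that the finite sum already has \<open>u k\<close> as its Fourier
  coefficient at \<open>k\<close>.\<close>

lemma expsum_approx:
  fixes u :: "int ^ 'n \<Rightarrow> complex"
  assumes "(\<lambda>k. cmod (u k)) summable_on UNIV" "0 < \<epsilon>"
  obtains S where "finite S" "k \<in> S"
    "\<And>w. cmod ((\<Sum>k\<in>S. u k * exp (- (2 * complex_of_real pi * \<i> * complex_of_real (w \<bullet> zvec k)))) - expsum u w) \<le> \<epsilon>"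
proof -
  let ?e = "\<lambda>w k. u k * exp (- (2 * complex_of_real pi * \<i> * complex_of_real (w \<bullet> zvec k)))"
  have "uniform_limit UNIV (\<lambda>S w. \<Sum>k\<in>S. ?e w k) (\<lambda>w. expsum u w) (finite_subsets_at_top UNIV)"
    unfolding expsum_def
    by (rule Weierstrass_m_test_general[where M = "\<lambda>k. cmod (u k)"]) (auto simp: norm_mult assms)
  then have "\<forall>\<^sub>F S in finite_subsets_at_top UNIV. \<forall>w. dist (\<Sum>k\<in>S. ?e w k) (expsum u w) < \<epsilon>"
    using assms(2) by (auto dest: uniform_limitD)
  then obtain X where X: "finite X" "\<And>S. finite S \<Longrightarrow> X \<subseteq> S \<Longrightarrow> \<forall>w. dist (\<Sum>k\<in>S. ?e w k) (expsum u w) < \<epsilon>"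
    by (auto simp: eventually_finite_subsets_at_top)
  show ?thesis
    using X(1) X(2)[OF finite.insertI[OF X(1)] subset_insertI, of k]
    by (intro that[of "insert k X"]) (auto simp: dist_norm less_imp_le)
qed

lemma continuous_on_expsum:
  fixes u :: "int ^ 'n \<Rightarrow> complex"
  assumes "(\<lambda>k. cmod (u k)) summable_on UNIV"
  shows "continuous_on A (expsum u)"
proof -
  let ?e = "\<lambda>w k. u k * exp (- (2 * complex_of_real pi * \<i> * complex_of_real (w \<bullet> zvec k)))"
  have "uniform_limit A (\<lambda>S w. \<Sum>k\<in>S. ?e w k) (expsum u) (finite_subsets_at_top UNIV)"
    unfolding expsum_def[abs_def]
    by (rule Weierstrass_m_test_general[where M = "\<lambda>k. cmod (u k)"]) (auto simp: norm_mult assms)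
  then show ?thesis
    by (rule uniform_limit_theorem[rotated]) (auto intro!: continuous_intros always_eventually)
qed

lemma borel_measurable_torus [measurable_dest]:
  "h \<in> borel_measurable borel \<Longrightarrow> h \<in> borel_measurable (lebesgue_on torus)"
  by (intro measurable_restrict_space1 measurable_completion) auto

lemma expsum_measurable:
  assumes "(\<lambda>k. cmod (u k)) summable_on UNIV"
  shows "expsum u \<in> borel_measurable borel"
  using continuous_on_expsum[OF assms] by (rule borel_measurable_continuous_onI)

text \<open>A finite partial sum multiplied by the conjugate character integrates to exactly
  \<open>u k\<close>, by orthogonality. The uniform error \<epsilon> of the partial sum contributes
  at most \<epsilon> because the torus has measure 1, so no infinite sum is exchanged with the
  integral.\<close>

lemma coefficient_le_nn_integral:
  fixes u :: "int ^ 'n \<Rightarrow> complex"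
  assumes u: "(\<lambda>k. cmod (u k)) summable_on UNIV"
  shows "ennreal (cmod (u k)) \<le> (\<integral>\<^sup>+w. ennreal (cmod (expsum u w)) \<partial>lebesgue_on torus)"
proof (rule ennreal_le_epsilon)
  fix \<epsilon> :: real assume "0 < \<epsilon>"
  let ?M = "lebesgue_on (torus :: (real^'n) set)"
  let ?c = "\<lambda>w. exp (2 * complex_of_real pi * \<i> * complex_of_real (w \<bullet> zvec k))"
  obtain S where S: "finite S" "k \<in> S"
    "\<And>w. cmod ((\<Sum>k\<in>S. u k * exp (- (2 * complex_of_real pi * \<i> * complex_of_real (w \<bullet> zvec k)))) - expsum u w) \<le> \<epsilon>"
    using expsum_approx[OF u \<open>0 < \<epsilon>\<close>, of k] by blast
  define p where "p w = (\<Sum>k\<in>S. u k * exp (- (2 * complex_of_real pi * \<i> * complex_of_real (w \<bullet> zvec k))))" for w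
  have [simp]: "emeasure ?M torus = 1"
    by (rule emeasure_lebesgue_on_torus)
  have [measurable]: "expsum u \<in> borel_measurable ?M"
    by (intro borel_measurable_torus expsum_measurable u)
  have int: "integrable ?M (\<lambda>w. exp (2 * of_real pi * \<i> * of_real (w \<bullet> zvec l)))" for l :: "int^'n"
  proof (rule integrableI_bounded)
    show "(\<lambda>w. exp (2 * of_real pi * \<i> * of_real (w \<bullet> zvec l)) :: complex) \<in> borel_measurable ?M"
      by (rule borel_measurable_torus) measurable
  qed simp
  have eq: "p w * ?c w = (\<Sum>l\<in>S. u l * exp (2 * of_real pi * \<i> * of_real (w \<bullet> zvec (k - l))))" for w
  proof -
    have "exp (- (2 * complex_of_real pi * \<i> * complex_of_real (w \<bullet> zvec l))) * ?c w
       = exp (2 * of_real pi * \<i> * of_real (w \<bullet> zvec (k - l)))" for l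
      unfolding zvec_diff by (simp add: inner_diff_right algebra_simps flip: exp_add)
    then show ?thesis
      by (simp add: p_def sum_distrib_right mult.assoc)
  qed
  have "(LINT w|?M. p w * ?c w) = (\<Sum>l\<in>S. u l * (if l = k then 1 else 0))"
    unfolding eq using int by (simp add: integral_exp_torus eq_commute[of k])
  also have "\<dots> = u k"
    using S(1,2) by (simp add: if_distrib[of "\<lambda>x. _ * x"] cong: if_cong)
  finally have "ennreal (cmod (u k)) = ennreal (cmod (LINT w|?M. p w * ?c w))"
    by simp
  also have "\<dots> \<le> (\<integral>\<^sup>+w. ennreal (cmod (p w * ?c w)) \<partial>?M)"
    unfolding eq using int by (intro integral_norm_bound_ennreal) auto
  also have "\<dots> \<le> (\<integral>\<^sup>+w. ennreal (cmod (expsum u w)) + ennreal \<epsilon> \<partial>?M)"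
  proof (rule nn_integral_mono)
    fix w
    have "cmod (p w) \<le> cmod (expsum u w) + \<epsilon>"
      using S(3)[of w] norm_triangle_sub[of "p w" "expsum u w"] unfolding p_def by linarith
    then show "ennreal (cmod (p w * ?c w)) \<le> ennreal (cmod (expsum u w)) + ennreal \<epsilon>"
      using \<open>0 < \<epsilon>\<close> by (simp add: norm_mult flip: ennreal_plus)
  qed
  also have "\<dots> = (\<integral>\<^sup>+w. ennreal (cmod (expsum u w)) \<partial>?M) + ennreal \<epsilon>"
    by (subst nn_integral_add) auto
  finally show "ennreal (cmod (u k)) \<le> (\<integral>\<^sup>+w. ennreal (cmod (expsum u w)) \<partial>?M) + ennreal \<epsilon>" .
qed

section \<open>Schwartz sequences and their dual\<close>

lemma summable_on_inverse_square_int: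
  "(\<lambda>j::int. 1 / (1 + \<bar>real_of_int j\<bar>) ^ 2) summable_on UNIV"
proof -
  let ?h = "\<lambda>j::int. 1 / (1 + \<bar>real_of_int j\<bar>) ^ 2"
  have "summable (\<lambda>n. inverse (real (Suc n) ^ 2))"
    using inverse_power_summable[of 2, where 'a = real] by (subst summable_Suc_iff) simp
  then have nat: "(\<lambda>n::nat. 1 / (1 + real n) ^ 2) summable_on UNIV"
    by (subst summable_on_UNIV_nonneg_real_iff) (auto simp: inverse_eq_divide add.commute)
  have "?h summable_on range int" "?h summable_on range (\<lambda>n. - int n)"
    using nat by (subst summable_on_reindex; simp add: inj_def o_def)+
  then have "?h summable_on (range int \<union> range (\<lambda>n. - int n))"
    by (rule summable_on_union)
  also have "range int \<union> range (\<lambda>n. - int n) = UNIV"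
    by (metis (no_types, lifting) UNIV_eq_I UnI1 UnI2 int_cases2 rangeI)
  finally show ?thesis .
qed

text \<open>A finite set of vectors lies in a box \<open>T^n\<close>, where \<open>T\<close>
  collects all their coordinates. Over the box the sum of products is the product of the
  one-dimensional sums.\<close>

lemma summable_on_prod_vec:
  fixes h :: "'a \<Rightarrow> real"
  assumes h: "h summable_on UNIV" and nonneg: "\<And>j. 0 \<le> h j"
  shows "(\<lambda>k::'a^'n. \<Prod>i\<in>UNIV. h (k $ i)) summable_on UNIV"
proof (rule nonneg_bounded_partial_sums_imp_summable_on)
  show "\<forall>\<^sub>F S in finite_subsets_at_top UNIV. (\<Sum>k\<in>S. \<Prod>i\<in>UNIV. h ((k::'a^'n) $ i)) \<le> infsum h UNIV ^ CARD('n)"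
  proof (rule eventually_finite_subsets_at_top_weakI)
    fix S :: "('a^'n) set" assume "finite S"
    define T where "T = (\<Union>i. (\<lambda>k. k $ i) ` S)"
    have "finite T" using \<open>finite S\<close> by (simp add: T_def)
    have "(\<Sum>k\<in>S. \<Prod>i\<in>UNIV. h (k $ i)) = (\<Sum>f\<in>vec_nth ` S. \<Prod>i\<in>UNIV. h (f i))"
      by (subst sum.reindex) (auto simp: inj_on_def vec_nth_inject)
    also have "\<dots> \<le> (\<Sum>f\<in>(UNIV \<rightarrow>\<^sub>E T). \<Prod>i\<in>(UNIV::'n set). h (f i))"
      by (rule sum_mono2) (auto simp: T_def intro!: prod_nonneg nonneg finite_PiE \<open>finite S\<close>)
    also have "\<dots> = (\<Prod>i\<in>(UNIV::'n set). \<Sum>j\<in>T. h j)"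
      using \<open>finite T\<close> by (subst prod_sum_PiE) auto
    also have "\<dots> \<le> (\<Prod>i\<in>(UNIV::'n set). infsum h UNIV)"
      by (intro prod_mono conjI finite_sum_le_infsum sum_nonneg h nonneg \<open>finite T\<close>) (auto intro: nonneg)
    finally show "(\<Sum>k\<in>S. \<Prod>i\<in>UNIV. h (k $ i)) \<le> infsum h UNIV ^ CARD('n)"
      by simp
  qed
qed (auto intro!: prod_nonneg nonneg)

text \<open>Each coordinate satisfies \<open>|k_i| <= |k|\<close>, so one factor
  \<open>(1 + |k|)^2\<close> per coordinate dominates the product of the
  \<open>(1 + |k_i|)^2\<close>; this is where the exponent \<open>2 * CARD('n)\<close> comes
  from.\<close>

lemma summable_on_inverse_power:
  "(\<lambda>k::int^'n. 1 / (1 + norm (zvec k)) ^ (2 * CARD('n))) summable_on UNIV"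
proof (rule summable_on_comparison_test[OF summable_on_prod_vec[OF summable_on_inverse_square_int]])
  fix k :: "int^'n"
  have "(\<Prod>i\<in>(UNIV::'n set). (1 + \<bar>real_of_int (k $ i)\<bar>) ^ 2) \<le> (\<Prod>i\<in>(UNIV::'n set). (1 + norm (zvec k)) ^ 2)"
    using component_le_norm_cart[of "zvec k"] by (intro prod_mono conjI power_mono) (auto simp: zvec_def)
  also have "\<dots> = (1 + norm (zvec k)) ^ (2 * CARD('n))"
    by (simp add: power_mult)
  finally have *: "(\<Prod>i\<in>(UNIV::'n set). (1 + \<bar>real_of_int (k $ i)\<bar>) ^ 2) \<le> \<dots>" .
  have "0 < (\<Prod>i\<in>(UNIV::'n set). (1 + \<bar>real_of_int (k $ i)\<bar>) ^ 2)"
    by (intro prod_pos) (auto intro: add_pos_nonneg)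
  from divide_left_mono[OF * _ mult_pos_pos[OF less_le_trans[OF this *] this], of 1]
  show "1 / (1 + norm (zvec k)) ^ (2 * CARD('n)) \<le> (\<Prod>i\<in>UNIV. 1 / (1 + \<bar>real_of_int (k $ i)\<bar>) ^ 2)"
    by (simp add: prod_dividef)
qed auto

section \<open>Decay of Schwartz sequences with natural exponents\<close>

lemma schwartz_decay:
  fixes g :: "int^'n \<Rightarrow> complex"
  assumes "g \<in> schwartz"
  obtains C where "0 \<le> C" "\<And>k. (1 + norm (zvec k)) ^ j * cmod (g k) \<le> C"
proof -
  obtain C where C: "\<And>k. cmod (g k) \<le> C * (1 + norm (zvec k)) powr (- real j)"
    using assms unfolding schwartz_def by blast
  have *: "(1 + norm (zvec k)) ^ j * cmod (g k) \<le> C" for k :: "int^'n"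
  proof -
    have "0 < 1 + norm (zvec k)" by (simp add: add_pos_nonneg)
    then show ?thesis
      using C[of k] by (simp add: powr_minus powr_realpow field_simps)
  qed
  moreover have "0 \<le> C"
    by (rule order_trans[OF _ *[of 0]]) simp
  ultimately show ?thesis using that by blast
qed

text \<open>Natural exponents are enough because the base is at least 1, so that the next larger
  natural exponent controls a real one.\<close>

lemma schwartzI:
  fixes g :: "int^'n \<Rightarrow> complex"
  assumes "\<And>j. \<exists>C. \<forall>k. (1 + norm (zvec k)) ^ j * cmod (g k) \<le> C"
  shows "g \<in> schwartz"
  unfolding schwartz_def
proof (intro CollectI allI)
  fix M :: real
  obtain j :: nat where j: "M \<le> real j" using real_arch_simple by blast
  obtain C where C: "\<And>k. (1 + norm (zvec k)) ^ j * cmod (g k) \<le> C"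
    using assms[of j] by blast
  have "0 \<le> C"
    by (rule order_trans[OF _ C[of 0]]) simp
  have "cmod (g k) \<le> C * (1 + norm (zvec k)) powr (- M)" for k
  proof -
    have "0 < 1 + norm (zvec k)" by (simp add: add_pos_nonneg)
    then have "cmod (g k) \<le> C * (1 + norm (zvec k)) powr (- real j)"
      using C[of k] by (simp add: powr_minus powr_realpow field_simps)
    also have "\<dots> \<le> C * (1 + norm (zvec k)) powr (- M)"
      using j \<open>0 \<le> C\<close> by (intro mult_left_mono powr_mono) auto
    finally show ?thesis .
  qed
  then show "\<exists>C. \<forall>k. cmod (g k) \<le> C * (1 + norm (zvec k)) powr (- M)" by blast
qed

lemma schwartz_combination:
  assumes "\<phi> \<in> schwartz" "\<psi> \<in> schwartz"
  shows "(\<lambda>k. a * \<phi> k + b * \<psi> k) \<in> schwartz"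
proof (rule schwartzI)
  fix j
  obtain C where C: "\<And>k. (1 + norm (zvec k)) ^ j * cmod (\<phi> k) \<le> C"
    using schwartz_decay[OF assms(1)] by metis
  obtain D where D: "\<And>k. (1 + norm (zvec k)) ^ j * cmod (\<psi> k) \<le> D"
    using schwartz_decay[OF assms(2)] by metis
  have "(1 + norm (zvec k)) ^ j * cmod (a * \<phi> k + b * \<psi> k) \<le> cmod a * C + cmod b * D" for k
  proof -
    have "(1 + norm (zvec k)) ^ j * cmod (a * \<phi> k + b * \<psi> k)
        \<le> (1 + norm (zvec k)) ^ j * (cmod a * cmod (\<phi> k) + cmod b * cmod (\<psi> k))"
      using norm_triangle_ineq[of "a * \<phi> k" "b * \<psi> k"] by (intro mult_left_mono) (auto simp: norm_mult)
    also have "\<dots> = cmod a * ((1 + norm (zvec k)) ^ j * cmod (\<phi> k)) + cmod b * ((1 + norm (zvec k)) ^ j * cmod (\<psi> k))"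
      by (simp add: algebra_simps)
    also have "\<dots> \<le> cmod a * C + cmod b * D"
      by (intro add_mono mult_left_mono C D) auto
    finally show ?thesis .
  qed
  then show "\<exists>C. \<forall>k. (1 + norm (zvec k)) ^ j * cmod (a * \<phi> k + b * \<psi> k) \<le> C" by blast
qed

lemma schwartz_diff: "\<phi> \<in> schwartz \<Longrightarrow> \<psi> \<in> schwartz \<Longrightarrow> \<phi> - \<psi> \<in> schwartz"
  using schwartz_combination[of \<phi> \<psi> 1 "-1"] by (simp add: fun_diff_def)

lemma finite_support_schwartz:
  fixes \<phi> :: "int^'n \<Rightarrow> complex"
  assumes "finite {k. \<phi> k \<noteq> 0}"
  shows "\<phi> \<in> schwartz"
proof (rule schwartzI)
  fix j
  let ?h = "\<lambda>k. (1 + norm (zvec k)) ^ j * cmod (\<phi> k)"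
  have "?h k \<le> (\<Sum>k | \<phi> k \<noteq> 0. ?h k)" for k
    using member_le_sum[of k "{k. \<phi> k \<noteq> 0}" ?h] assms by (cases "\<phi> k = 0") (auto intro: sum_nonneg)
  then show "\<exists>C. \<forall>k. ?h k \<le> C" by blast
qed

lemma le_schwartz_seminorm:
  assumes "\<phi> \<in> schwartz"
  shows "(1 + norm (zvec k)) ^ j * cmod (\<phi> k) \<le> schwartz_seminorm j \<phi>"
  unfolding schwartz_seminorm_def
proof (rule cSUP_upper)
  obtain C where "\<And>k. (1 + norm (zvec k)) ^ j * cmod (\<phi> k) \<le> C"
    using schwartz_decay[OF assms] by metis
  then show "bdd_above (range (\<lambda>k. (1 + norm (zvec k)) ^ j * cmod (\<phi> k)))" by fast
qed simp

text \<open>Decay of order \<open>j + 2 * CARD('n)\<close> pays for the weight and leaves a summable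
  inverse power.\<close>

lemma schwartz_moment_summable:
  fixes g :: "int^'n \<Rightarrow> complex"
  assumes "g \<in> schwartz"
  shows "(\<lambda>k. (1 + norm (zvec k)) ^ j * cmod (g k)) summable_on UNIV"
proof -
  obtain C where C: "\<And>k. (1 + norm (zvec k)) ^ (j + 2 * CARD('n)) * cmod (g k) \<le> C"
    using schwartz_decay[OF assms] by metis
  show ?thesis
  proof (rule summable_on_comparison_test[OF summable_on_cmult_right[OF summable_on_inverse_power, of C]])
    fix k :: "int^'n"
    have "0 < 1 + norm (zvec k)" by (simp add: add_pos_nonneg)
    then have "0 < (1 + norm (zvec k)) ^ (2 * CARD('n))" by simp
    then show "(1 + norm (zvec k)) ^ j * cmod (g k) \<le> C * (1 / (1 + norm (zvec k)) ^ (2 * CARD('n)))"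
      using C[of k] by (simp add: power_add field_simps)
  qed auto
qed

lemma schwartz_summable: "g \<in> schwartz \<Longrightarrow> (\<lambda>k. cmod (g k)) summable_on UNIV"
  using schwartz_moment_summable[of g 0] by simp

text \<open>Continuity at 0 provides finitely many seminorms whose smallness forces
  \<open>|f| < 1\<close>. A unit sequence at \<open>k\<close>, scaled by \<open>s\<close>, has
  seminorms at most \<open>s (1 + |k|)^N\<close>, so \<open>s\<close> may be taken of order
  \<open>(1 + |k|)^(-N)\<close> and the coefficient is less than \<open>1 / s\<close>.\<close>

lemma coef_growth:
  fixes f :: "(int^'n \<Rightarrow> complex) \<Rightarrow> complex"
  assumes "f \<in> schwartz_dual"
  obtains B N where "0 \<le> B" "\<And>k. cmod (coef f k) \<le> B * (1 + norm (zvec k)) ^ N"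
proof -
  have lin: "f (\<lambda>k. a * \<phi> k + b * \<psi> k) = a * f \<phi> + b * f \<psi>" if "\<phi> \<in> schwartz" "\<psi> \<in> schwartz" for a b \<phi> \<psi>
    using assms that unfolding schwartz_dual_def by blast
  have zero: "(\<lambda>k. 0) \<in> (schwartz :: (int^'n \<Rightarrow> complex) set)"
    by (rule finite_support_schwartz) simp
  have f0: "f (\<lambda>k. 0) = 0"
    using lin[OF zero zero, of 0 0] by simp
  have "continuous_map schwartz_topology euclidean f"
    using assms by (simp add: schwartz_dual_def)
  then have "openin schwartz_topology {\<phi> \<in> topspace schwartz_topology. f \<phi> \<in> ball 0 1}"
    by (rule openin_continuous_map_preimage) simp
  then have "\<forall>\<phi>\<in>{\<phi> \<in> schwartz. f \<phi> \<in> ball 0 1}. \<exists>J e. finite J \<and> 0 < e \<and>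
      {\<psi> \<in> schwartz. \<forall>j\<in>J. schwartz_seminorm j (\<psi> - \<phi>) < e} \<subseteq> {\<phi> \<in> schwartz. f \<phi> \<in> ball 0 1}"
    unfolding schwartz_topology_def topspace_seminorm_topology openin_seminorm_topology by (rule conjunct2)
  from bspec[OF this, of "\<lambda>k. 0"] obtain J e where J: "finite J" "0 < e"
    "{\<psi> \<in> schwartz. \<forall>j\<in>J. schwartz_seminorm j (\<psi> - (\<lambda>k. 0)) < e} \<subseteq> {\<phi> \<in> schwartz. f \<phi> \<in> ball 0 1}"
    using zero f0 by auto
  \<comment> \<open>Inserting 0 gives \<open>Max\<close> a nonempty set when \<open>J\<close> is
    empty.\<close>
  define N where "N = Max (insert 0 J)"
  have "cmod (coef f k) \<le> 2 / e * (1 + norm (zvec k)) ^ N" for k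
  proof -
    define s where "s = e / (2 * (1 + norm (zvec k)) ^ N)"
    have pos: "0 < (1 + norm (zvec k)) ^ N" by (simp add: add_pos_nonneg)
    then have "0 < s" using J(2) by (simp add: s_def)
    let ?\<delta> = "\<lambda>l. if l = k then 1 else 0 :: complex"
    \<comment> \<open>The zero summand brings the scaled unit sequence into the two-term form of the
      linearity clause in \<open>schwartz_dual\<close>.\<close>
    let ?\<phi> = "\<lambda>l. of_real s * ?\<delta> l + 0 * ?\<delta> l"
    have \<delta>: "?\<delta> \<in> schwartz"
      by (rule finite_support_schwartz) simp
    have \<phi>: "?\<phi> \<in> schwartz"
      by (rule schwartz_combination[OF \<delta> \<delta>])
    have "schwartz_seminorm j (?\<phi> - (\<lambda>k. 0)) < e" if "j \<in> J" for j
    proof -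
      have "j \<le> N" using that J(1) by (simp add: N_def)
      have "schwartz_seminorm j (?\<phi> - (\<lambda>k. 0)) \<le> (1 + norm (zvec k)) ^ N * s"
        unfolding schwartz_seminorm_def
        using \<open>j \<le> N\<close> \<open>0 < s\<close> by (intro cSUP_least) (auto intro!: power_increasing mult_right_mono)
      also have "\<dots> < e"
        using pos J(2) by (simp add: s_def)
      finally show ?thesis .
    qed
    then have "cmod (f ?\<phi>) < 1"
      using J(3) \<phi> by (auto simp: subset_iff)
    also have "f ?\<phi> = of_real s * coef f k"
      using lin[OF \<delta> \<delta>, of "of_real s" 0] by (simp add: coef_def)
    finally have "s * cmod (coef f k) < 1"
      using \<open>0 < s\<close> by (simp add: norm_mult)
    then show ?thesis
      using pos J(2) by (simp add: s_def field_simps)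
  qed
  then show ?thesis using that[of "2 / e" N] J(2) by auto
qed

text \<open>The inequality \<open>1 + |k| <= (1 + |m|) (1 + |k - m|)\<close> moves the polynomial
  growth of the coefficients onto the shifted window, whose decay absorbs it.\<close>

lemma coef_window_summable:
  fixes g :: "int^'n \<Rightarrow> complex"
  assumes "f \<in> schwartz_dual" "g \<in> schwartz"
  shows "(\<lambda>k. cmod (coef f k * cnj (g (k - m)))) summable_on UNIV"
proof -
  obtain B N where B: "0 \<le> B" "\<And>k. cmod (coef f k) \<le> B * (1 + norm (zvec k)) ^ N"
    using coef_growth[OF assms(1)] by blast
  have "bij_betw (\<lambda>k. k - m) UNIV UNIV"
    by (rule bij_betwI[where g = "\<lambda>k. k + m"]) auto
  from summable_on_reindex_bij_betw[OF this, THEN iffD2, OF schwartz_moment_summable[OF assms(2), of N]]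
  have "(\<lambda>k. (B * (1 + norm (zvec m)) ^ N) * ((1 + norm (zvec (k - m))) ^ N * cmod (g (k - m)))) summable_on UNIV"
    by (rule summable_on_cmult_right)
  then show ?thesis
  proof (rule summable_on_comparison_test)
    fix k :: "int^'n"
    have "norm (zvec k) \<le> norm (zvec (k - m)) + norm (zvec m)"
      using norm_triangle_ineq[of "zvec k - zvec m" "zvec m"] unfolding zvec_diff by simp
    moreover have "0 \<le> norm (zvec m) * norm (zvec (k - m))" by simp
    moreover have "(1 + norm (zvec m)) * (1 + norm (zvec (k - m)))
        = 1 + norm (zvec m) + norm (zvec (k - m)) + norm (zvec m) * norm (zvec (k - m))"
      by (simp add: ring_distribs)
    ultimately have "1 + norm (zvec k) \<le> (1 + norm (zvec m)) * (1 + norm (zvec (k - m)))"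
      by linarith
    then have "(1 + norm (zvec k)) ^ N \<le> (1 + norm (zvec m)) ^ N * (1 + norm (zvec (k - m))) ^ N"
      by (metis norm_ge_zero power_mono power_mult_distrib add_nonneg_nonneg zero_le_one)
    then have "cmod (coef f k) \<le> B * ((1 + norm (zvec m)) ^ N * (1 + norm (zvec (k - m))) ^ N)"
      using B by (meson mult_left_mono order_trans)
    then show "cmod (coef f k * cnj (g (k - m))) \<le> (B * (1 + norm (zvec m)) ^ N) * ((1 + norm (zvec (k - m))) ^ N * cmod (g (k - m)))"
      by (simp add: norm_mult mult_right_mono flip: mult.assoc)
  qed auto
qed

section \<open>Modulars\<close>

text \<open>For \<open>x \<ge> 0\<close>, convexity and \<open>\<Phi> 0 = 0\<close> are only used through
  \<open>\<Phi> (t x) \<le> t \<Phi> x\<close>, that is, through the monotonicity of \<open>\<Phi> x / x\<close>.\<close>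

definition modular :: "(ennreal \<Rightarrow> ennreal) \<Rightarrow> bool" where
  "modular \<Phi> \<longleftrightarrow>
     (\<forall>t x. 0 \<le> t \<longrightarrow> t \<le> 1 \<longrightarrow> 0 \<le> x \<longrightarrow> \<Phi> (ennreal (t * x)) \<le> ennreal t * \<Phi> (ennreal x)) \<and>
     (\<exists>y>0. 1 < \<Phi> (ennreal y)) \<and> (\<exists>y>0. \<Phi> (ennreal y) < \<infinity>)"

lemma modular_scale:
  "modular \<Phi> \<Longrightarrow> 0 \<le> t \<Longrightarrow> t \<le> 1 \<Longrightarrow> 0 \<le> x \<Longrightarrow> \<Phi> (ennreal (t * x)) \<le> ennreal t * \<Phi> (ennreal x)"
  by (simp add: modular_def)

lemma modular_0: "modular \<Phi> \<Longrightarrow> \<Phi> 0 = 0"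
  using modular_scale[of \<Phi> 0 0] by simp

lemma modular_mono:
  assumes "modular \<Phi>" "0 \<le> x" "x \<le> y"
  shows "\<Phi> (ennreal x) \<le> \<Phi> (ennreal y)"
proof (cases "y = 0")
  case False
  then have "\<Phi> (ennreal (x / y * y)) \<le> ennreal (x / y) * \<Phi> (ennreal y)"
    using assms by (intro modular_scale) auto
  also have "\<dots> \<le> 1 * \<Phi> (ennreal y)"
    using assms False by (intro mult_right_mono) (auto simp: ennreal_le_1)
  finally show ?thesis using False by simp
qed (use assms in auto)

text \<open>The factor \<open>2\<close> lost in comparison with Jensen's inequality is harmless for norms up to
  equivalence. The bound \<open>\<Phi> (X x) \<ge> \<Phi> y (X x - y)\<^sup>+ / y\<close> has a measurable right-hand side, so \<open>\<Phi>\<close>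
  need not be measurable.\<close>

lemma weak_jensen:
  fixes X :: "'a \<Rightarrow> real"
  assumes \<Phi>: "modular \<Phi>" and M: "emeasure M (space M) \<le> 1"
    and X: "X \<in> borel_measurable M" "\<And>x. 0 \<le> X x"
    and y: "0 \<le> y" "ennreal (2 * y) \<le> (\<integral>\<^sup>+x. ennreal (X x) \<partial>M)"
  shows "\<Phi> (ennreal y) \<le> (\<integral>\<^sup>+x. \<Phi> (ennreal (X x)) \<partial>M)"
proof (cases "y = 0")
  case True
  then show ?thesis using modular_0[OF \<Phi>] by simp
next
  case False
  with y have "0 < y" by simp
  note X(1)[measurable]
  \<comment> \<open>\<open>ennreal\<close> sends negative reals to 0, so the integrand is the
    positive part of \<open>X x - y\<close>.\<close>
  let ?I = "\<integral>\<^sup>+x. ennreal (X x - y) \<partial>M"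
  \<comment> \<open>The factor 2 is spent here: since the total mass is at most 1, cutting off at
    \<open>y\<close> costs at most one \<open>y\<close>, and the other one remains as a lower bound
    for \<open>?I\<close>.\<close>
  have "ennreal y + ennreal y \<le> (\<integral>\<^sup>+x. ennreal (X x) \<partial>M)"
    using y by (simp flip: ennreal_plus)
  also have "\<dots> \<le> (\<integral>\<^sup>+x. ennreal (X x - y) + ennreal y \<partial>M)"
  proof (rule nn_integral_mono)
    fix x
    show "ennreal (X x) \<le> ennreal (X x - y) + ennreal y"
      using \<open>0 < y\<close> by (cases "y \<le> X x") (auto simp: ennreal_neg ennreal_leI simp flip: ennreal_plus)
  qed
  also have "\<dots> = ?I + ennreal y * emeasure M (space M)"
    by (subst nn_integral_add) auto
  also have "\<dots> \<le> ?I + ennreal y * 1"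
    by (intro add_left_mono mult_left_mono M) auto
  finally have "ennreal y \<le> ?I"
    by (simp add: add.commute[of ?I] ennreal_add_left_cancel_le)
  then have "ennreal (1 / y) * ennreal y \<le> ennreal (1 / y) * ?I"
    by (rule mult_left_mono) simp
  then have one: "1 \<le> ennreal (1 / y) * ?I"
    using \<open>0 < y\<close> by (simp flip: ennreal_mult)
  have "\<Phi> (ennreal y) = \<Phi> (ennreal y) * 1" by simp
  also have "\<dots> \<le> \<Phi> (ennreal y) * (ennreal (1 / y) * ?I)"
    by (intro mult_left_mono one) auto
  also have "\<dots> = (\<integral>\<^sup>+x. \<Phi> (ennreal y) * (ennreal (1 / y) * ennreal (X x - y)) \<partial>M)"
    by (simp add: nn_integral_cmult)
  also have "\<dots> \<le> (\<integral>\<^sup>+x. \<Phi> (ennreal (X x)) \<partial>M)"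
  proof (rule nn_integral_mono)
    fix x
    show "\<Phi> (ennreal y) * (ennreal (1 / y) * ennreal (X x - y)) \<le> \<Phi> (ennreal (X x))"
    proof (cases "X x \<le> y")
      case True
      then show ?thesis by (simp add: ennreal_neg)
    next
      case False
      then have less: "y < X x" by simp
      have "\<Phi> (ennreal y) = \<Phi> (ennreal (y / X x * X x))"
        using less \<open>0 < y\<close> by simp
      also have "\<dots> \<le> ennreal (y / X x) * \<Phi> (ennreal (X x))"
        using less \<open>0 < y\<close> by (intro modular_scale[OF \<Phi>]) auto
      finally have "\<Phi> (ennreal y) * (ennreal (1 / y) * ennreal (X x - y))
          \<le> (ennreal (y / X x) * \<Phi> (ennreal (X x))) * (ennreal (1 / y) * ennreal (X x - y))"
        by (rule mult_right_mono) simp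
      also have "\<dots> = (ennreal (y / X x) * (ennreal (1 / y) * ennreal (X x - y))) * \<Phi> (ennreal (X x))"
        by (simp add: mult_ac)
      also have "ennreal (y / X x) * (ennreal (1 / y) * ennreal (X x - y)) = ennreal ((X x - y) / X x)"
        using less \<open>0 < y\<close> by (simp flip: ennreal_mult add: field_simps)
      also have "ennreal ((X x - y) / X x) * \<Phi> (ennreal (X x)) \<le> 1 * \<Phi> (ennreal (X x))"
        using less \<open>0 < y\<close> by (intro mult_right_mono) (auto simp: ennreal_le_1)
      finally show ?thesis by simp
    qed
  qed
  finally show ?thesis .
qed

section \<open>Passing between the short-time Fourier transform and the coefficients\<close>

lemma stft_eq_expsum: "stft g f (m, w) = expsum (\<lambda>k. coef f k * cnj (g (k - m))) w"
  by (simp add: stft_def expsum_def)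

lemma stft_measurable:
  assumes "f \<in> schwartz_dual" "g \<in> schwartz"
  shows "(\<lambda>w. stft g f (m, w)) \<in> borel_measurable (lebesgue_on torus)"
  unfolding stft_eq_expsum by (intro borel_measurable_torus expsum_measurable coef_window_summable assms)

lemma nn_integral_count_space_infsum:
  fixes h :: "'a \<Rightarrow> real"
  assumes "h summable_on UNIV" "\<And>x. 0 \<le> h x"
  shows "(\<integral>\<^sup>+x. ennreal (h x) \<partial>count_space UNIV) = ennreal (infsum h UNIV)"
proof -
  have abs: "Infinite_Set_Sum.abs_summable_on h UNIV"
    using assms by (intro abs_summable_equivalent[THEN iffD1]) simp
  show ?thesis
    using nn_integral_conv_infsetsum[OF abs] infsetsum_infsum[OF abs] assms(2) by simp
qed

lemma infsum_divide_right:
  fixes h :: "'a \<Rightarrow> real"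
  shows "h summable_on A \<Longrightarrow> (\<lambda>x. h x / c) summable_on A" "infsum (\<lambda>x. h x / c) A = infsum h A / c"
  by (simp_all add: divide_inverse summable_on_cmult_left infsum_cmult_left')

text \<open>At \<open>m = k - k0\<close> the Fourier coefficient of index \<open>k\<close> of the
  transform is \<open>coef f k * cnj (g k0)\<close>, so a single value of the window recovers all
  coefficients. The shift by \<open>k0\<close> is a bijection, hence summing over \<open>k\<close>
  sums over all \<open>m\<close>. The 2 is that of \<open>weak_jensen\<close>.\<close>

lemma nn_integral_coef_le_phase_integral:
  fixes g :: "int^'n \<Rightarrow> complex"
  assumes \<Phi>: "modular \<Phi>" and f: "f \<in> schwartz_dual" and g: "g \<in> schwartz" and "0 < b"
  shows "(\<integral>\<^sup>+k. \<Phi> (ennreal (cmod (coef f k) * cmod (g k0) / (2 * b))) \<partial>count_space UNIV)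
    \<le> phase_integral (\<lambda>z. \<Phi> (ennreal (cmod (stft g f z) / b)))"
proof -
  have bij: "bij_betw (\<lambda>k. k - k0) UNIV UNIV"
    by (rule bij_betwI[where g = "\<lambda>k. k + k0"]) auto
  have "(\<integral>\<^sup>+k. \<Phi> (ennreal (cmod (coef f k) * cmod (g k0) / (2 * b))) \<partial>count_space UNIV)
    \<le> (\<integral>\<^sup>+k. (\<integral>\<^sup>+w. \<Phi> (ennreal (cmod (stft g f (k - k0, w)) / b)) \<partial>lebesgue_on torus) \<partial>count_space UNIV)"
  proof (intro nn_integral_mono weak_jensen[OF \<Phi>])
    fix k
    let ?u = "\<lambda>l. coef f l * cnj (g (l - (k - k0)))"
    note stft_measurable[OF f g, measurable]
    show "(\<lambda>w. cmod (stft g f (k - k0, w)) / b) \<in> borel_measurable (lebesgue_on torus)"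
      by measurable
    have "ennreal (2 * (cmod (coef f k) * cmod (g k0) / (2 * b))) = ennreal (1 / b) * ennreal (cmod (?u k))"
      using \<open>0 < b\<close> by (simp add: norm_mult flip: ennreal_mult)
    also have "\<dots> \<le> ennreal (1 / b) * (\<integral>\<^sup>+w. ennreal (cmod (expsum ?u w)) \<partial>lebesgue_on torus)"
      by (intro mult_left_mono coefficient_le_nn_integral coef_window_summable f g) simp
    also have "\<dots> = (\<integral>\<^sup>+w. ennreal (1 / b) * ennreal (cmod (stft g f (k - k0, w))) \<partial>lebesgue_on torus)"
      unfolding stft_eq_expsum[symmetric] by (rule nn_integral_cmult[symmetric]) measurable
    finally show "ennreal (2 * (cmod (coef f k) * cmod (g k0) / (2 * b)))
        \<le> (\<integral>\<^sup>+w. ennreal (cmod (stft g f (k - k0, w)) / b) \<partial>lebesgue_on torus)"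
      using \<open>0 < b\<close> by (simp flip: ennreal_mult)
  qed (use \<open>0 < b\<close> in \<open>auto simp: emeasure_lebesgue_on_torus\<close>)
  also have "\<dots> = phase_integral (\<lambda>z. \<Phi> (ennreal (cmod (stft g f z) / b)))"
    unfolding phase_integral_def by (rule nn_integral_bij_count_space[OF bij])
  finally show ?thesis .
qed

lemma nn_integral_count_space_shift:
  fixes h :: "'a::group_add \<Rightarrow> ennreal"
  shows "(\<integral>\<^sup>+k. h (k - m) \<partial>count_space UNIV) = (\<integral>\<^sup>+k. h k \<partial>count_space UNIV)"
    and "(\<integral>\<^sup>+m. h (k - m) \<partial>count_space UNIV) = (\<integral>\<^sup>+k. h k \<partial>count_space UNIV)"
  by (rule nn_integral_bij_count_space,
      rule bij_betwI[where g = "\<lambda>k. k + m"] bij_betwI[where g = "\<lambda>j. - j + k"]; simp add: algebra_simps)+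

text \<open>The weights \<open>|g| / G\<close>, shifted by \<open>m\<close>, form a probability
  measure, and \<open>|V f(m, w)| / G\<close> is at most the mean of \<open>|f|\<close> under it.
  The resulting bound does not depend on \<open>w\<close>. After exchanging the sums by Tonelli, the
  weights add up to 1 over \<open>m\<close> as well, so the window leaves no trace on the right-hand
  side.\<close>

lemma phase_integral_le_nn_integral_coef:
  fixes g :: "int^'n \<Rightarrow> complex"
  assumes \<Phi>: "modular \<Phi>" and f: "f \<in> schwartz_dual" and g: "g \<in> schwartz" and "0 < \<eta>"
    and G: "G = (\<Sum>\<^sub>\<infinity>k. cmod (g k))" "0 < G"
  shows "phase_integral (\<lambda>z. \<Phi> (ennreal (cmod (stft g f z) / (2 * G * \<eta>))))
    \<le> (\<integral>\<^sup>+k. \<Phi> (ennreal (cmod (coef f k) / \<eta>)) \<partial>count_space UNIV)"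
proof -
  define \<rho> where "\<rho> k = cmod (g k) / G" for k
  have \<rho>_nonneg: "0 \<le> \<rho> k" for k
    using G by (simp add: \<rho>_def)
  have "(\<integral>\<^sup>+k. ennreal (\<rho> k) \<partial>count_space UNIV) = ennreal (\<Sum>\<^sub>\<infinity>k. \<rho> k)"
    unfolding \<rho>_def using schwartz_summable[OF g] G(2)
    by (intro nn_integral_count_space_infsum infsum_divide_right(1)) auto
  also have "(\<Sum>\<^sub>\<infinity>k. \<rho> k) = 1"
    unfolding \<rho>_def using G by (simp add: infsum_divide_right(2))
  finally have \<rho>1: "(\<integral>\<^sup>+k. ennreal (\<rho> k) \<partial>count_space UNIV) = 1" by simp
  have bound: "\<Phi> (ennreal (cmod (stft g f (m, w)) / (2 * G * \<eta>)))
      \<le> (\<integral>\<^sup>+k. ennreal (\<rho> (k - m)) * \<Phi> (ennreal (cmod (coef f k) / \<eta>)) \<partial>count_space UNIV)" (is "_ \<le> ?R m") for m w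
  proof -
    let ?M = "density (count_space UNIV) (\<lambda>k. ennreal (\<rho> (k - m)))"
    let ?u = "\<lambda>k. coef f k * cnj (g (k - m))"
    have "\<Phi> (ennreal (cmod (stft g f (m, w)) / (2 * G * \<eta>)))
      \<le> (\<integral>\<^sup>+k. \<Phi> (ennreal (cmod (coef f k) / \<eta>)) \<partial>?M)"
    proof (rule weak_jensen[OF \<Phi>])
      show "emeasure ?M (space ?M) \<le> 1"
        by (simp add: emeasure_density nn_integral_count_space_shift(1)[of "\<lambda>k. ennreal (\<rho> k)"] \<rho>1)
      have sum: "(\<lambda>k. cmod (?u k)) summable_on UNIV"
        by (rule coef_window_summable[OF f g])
      have "cmod (stft g f (m, w)) \<le> (\<Sum>\<^sub>\<infinity>k. cmod (?u k))"
        unfolding stft_eq_expsum expsum_def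
        by (rule order_trans[OF norm_infsum_bound]) (simp_all add: norm_mult[of "_ * _"] sum)
      then have "cmod (stft g f (m, w)) / (G * \<eta>) \<le> (\<Sum>\<^sub>\<infinity>k. cmod (?u k)) / (G * \<eta>)"
        using G \<open>0 < \<eta>\<close> by (intro divide_right_mono) auto
      also have "\<dots> = (\<Sum>\<^sub>\<infinity>k. cmod (?u k) / (G * \<eta>))"
        by (rule infsum_divide_right(2)[symmetric])
      finally have "ennreal (2 * (cmod (stft g f (m, w)) / (2 * G * \<eta>))) \<le> ennreal (\<Sum>\<^sub>\<infinity>k. cmod (?u k) / (G * \<eta>))"
        by (intro ennreal_leI) (simp add: field_simps)
      also have "\<dots> = (\<integral>\<^sup>+k. ennreal (cmod (?u k) / (G * \<eta>)) \<partial>count_space UNIV)"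
        using sum G \<open>0 < \<eta>\<close> by (intro nn_integral_count_space_infsum[symmetric] infsum_divide_right(1)) auto
      also have "\<dots> = (\<integral>\<^sup>+k. ennreal (\<rho> (k - m)) * ennreal (cmod (coef f k) / \<eta>) \<partial>count_space UNIV)"
        using G \<open>0 < \<eta>\<close> by (intro nn_integral_cong) (simp add: \<rho>_def norm_mult mult_ac flip: ennreal_mult)
      also have "\<dots> = (\<integral>\<^sup>+k. ennreal (cmod (coef f k) / \<eta>) \<partial>?M)"
        by (simp add: nn_integral_density)
      finally show "ennreal (2 * (cmod (stft g f (m, w)) / (2 * G * \<eta>))) \<le> (\<integral>\<^sup>+k. ennreal (cmod (coef f k) / \<eta>) \<partial>?M)" .
    qed (use G \<open>0 < \<eta>\<close> in auto)
    then show ?thesis by (simp add: nn_integral_density)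
  qed
  have "phase_integral (\<lambda>z. \<Phi> (ennreal (cmod (stft g f z) / (2 * G * \<eta>))))
      \<le> (\<integral>\<^sup>+m. (\<integral>\<^sup>+w. ?R m \<partial>lebesgue_on (torus :: (real^'n) set)) \<partial>count_space UNIV)"
    unfolding phase_integral_def by (intro nn_integral_mono bound)
  also have "\<dots> = (\<integral>\<^sup>+m. ?R m \<partial>count_space UNIV)"
    by (simp add: emeasure_lebesgue_on_torus)
  also have "\<dots> = (\<integral>\<^sup>+k. (\<integral>\<^sup>+m. ennreal (\<rho> (k - m)) * \<Phi> (ennreal (cmod (coef f k) / \<eta>)) \<partial>count_space UNIV) \<partial>count_space UNIV)"
    using nn_integral_fst_count_space[of "\<lambda>(m, k). ennreal (\<rho> (k - m)) * \<Phi> (ennreal (cmod (coef f k) / \<eta>))"]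
      nn_integral_snd_count_space[of "\<lambda>(m, k). ennreal (\<rho> (k - m)) * \<Phi> (ennreal (cmod (coef f k) / \<eta>))"]
    by simp
  also have "\<dots> = (\<integral>\<^sup>+k. \<Phi> (ennreal (cmod (coef f k) / \<eta>)) \<partial>count_space UNIV)"
    by (simp add: nn_integral_multc nn_integral_count_space_shift(2)[of "\<lambda>k. ennreal (\<rho> k)"] \<rho>1)
  finally show ?thesis .
qed

text \<open>The Young function \<open>x^p\<close>, through which the Lebesgue spaces are treated as
  Orlicz spaces. Infinity is a separate case because \<open>enn2real\<close> maps it to 0.\<close>

definition power_modular :: "real \<Rightarrow> ennreal \<Rightarrow> ennreal" where
  "power_modular p x = (if x = \<infinity> then \<infinity> else ennreal (enn2real x powr p))"

lemma power_modular_ennreal [simp]: "0 \<le> x \<Longrightarrow> power_modular p (ennreal x) = ennreal (x powr p)"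
  by (simp add: power_modular_def)

lemma modular_power:
  assumes "1 \<le> p"
  shows "modular (power_modular p)"
  unfolding modular_def
proof (intro conjI allI impI)
  fix t x :: real assume tx: "0 \<le> t" "t \<le> 1" "0 \<le> x"
  have "t powr p \<le> t powr 1"
    using tx assms by (intro powr_mono') auto
  then have "(t * x) powr p \<le> t * x powr p"
    using tx by (simp add: powr_mult mult_right_mono)
  then show "power_modular p (ennreal (t * x)) \<le> ennreal t * power_modular p (ennreal x)"
    using tx by (simp flip: ennreal_mult add: ennreal_leI del: ennreal_mult')
next
  have "1 < (2::real) powr p"
    using assms by (intro gr_one_powr) auto
  then show "\<exists>y>0. 1 < power_modular p (ennreal y)"
    by (intro exI[of _ 2]) (simp add: power_modular_ennreal del: ennreal_numeral)
  show "\<exists>y>0. power_modular p (ennreal y) < \<infinity>"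
    by (intro exI[of _ 1]) (simp add: power_modular_ennreal del: ennreal_1)
qed

text \<open>By homogeneity the integral at scale \<open>b\<close> is \<open>b^(-p)\<close> times the
  integral at scale 1, so the admissible scales are exactly the positive \<open>b\<close> with
  \<open>b >= I^(1/p)\<close>.\<close>

lemma Lp_norm_eq_orlicz_norm:
  assumes "0 < p" and F: "\<And>m. (\<lambda>w. F (m, w)) \<in> borel_measurable (lebesgue_on torus)"
  shows "Lp_norm p F = orlicz_norm (power_modular p) F"
proof -
  note F[measurable]
  let ?I = "phase_integral (\<lambda>z. ennreal (cmod (F z) powr p))"
  have scale: "phase_integral (\<lambda>z. power_modular p (ennreal (cmod (F z) / b))) = ennreal (b powr - p) * ?I"
    if "0 < b" for b
  proof -
    have "power_modular p (ennreal (cmod z / b)) = ennreal (b powr - p) * ennreal (cmod z powr p)" for z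
    proof -
      have "(cmod z / b) powr p = b powr - p * cmod z powr p"
        using that by (simp add: powr_divide powr_minus field_simps)
      then show ?thesis using that by (simp flip: ennreal_mult)
    qed
    then show ?thesis
      by (simp add: phase_integral_def nn_integral_cmult)
  qed
  show ?thesis
  proof (cases "?I = \<infinity>")
    case True
    have "{ennreal b | b. 0 < b \<and> phase_integral (\<lambda>z. power_modular p (ennreal (cmod (F z) / b))) \<le> 1} = {}"
      using True by (auto simp: scale ennreal_mult_top top_unique simp del: power_modular_ennreal)
    then show ?thesis
      unfolding orlicz_norm_def by (simp only: Inf_empty) (simp add: Lp_norm_def True)
  next
    case False
    then obtain r where r: "0 \<le> r" "?I = ennreal r"
      by (cases ?I) (auto simp: infinity_ennreal_def)
    have iff: "phase_integral (\<lambda>z. power_modular p (ennreal (cmod (F z) / b))) \<le> 1 \<longleftrightarrow> r powr (1 / p) \<le> b"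
      if "0 < b" for b
    proof -
      have "phase_integral (\<lambda>z. power_modular p (ennreal (cmod (F z) / b))) \<le> 1 \<longleftrightarrow> b powr - p * r \<le> 1"
        using that r by (simp add: scale del: power_modular_ennreal flip: ennreal_mult)
      also have "\<dots> \<longleftrightarrow> r \<le> b powr p"
        using that by (simp add: powr_minus field_simps)
      also have "\<dots> \<longleftrightarrow> r powr (1 / p) \<le> b"
      proof
        assume "r \<le> b powr p"
        then have "r powr (1 / p) \<le> (b powr p) powr (1 / p)"
          using \<open>0 < p\<close> r(1) by (intro powr_mono2) auto
        then show "r powr (1 / p) \<le> b" using that \<open>0 < p\<close> by (simp add: powr_powr)
      next
        assume "r powr (1 / p) \<le> b"
        then have "(r powr (1 / p)) powr p \<le> b powr p"
          using \<open>0 < p\<close> by (intro powr_mono2) auto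
        then show "r \<le> b powr p" using r(1) \<open>0 < p\<close> by (simp add: powr_powr)
      qed
      finally show ?thesis .
    qed
    have set: "{ennreal b | b. 0 < b \<and> phase_integral (\<lambda>z. power_modular p (ennreal (cmod (F z) / b))) \<le> 1}
        = {ennreal b | b. 0 < b \<and> r powr (1 / p) \<le> b}"
      using iff by blast
    have "Inf {ennreal b | b. 0 < b \<and> r powr (1 / p) \<le> b} = ennreal (r powr (1 / p))"
    proof (rule antisym)
      show "Inf {ennreal b | b. 0 < b \<and> r powr (1 / p) \<le> b} \<le> ennreal (r powr (1 / p))"
      proof (rule ennreal_le_epsilon)
        fix e :: real assume "0 < e"
        then have "ennreal (r powr (1 / p) + e) \<in> {ennreal b | b. 0 < b \<and> r powr (1 / p) \<le> b}"
          by (intro CollectI exI[of _ "r powr (1 / p) + e"]) (auto intro: add_nonneg_pos)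
        then show "Inf {ennreal b | b. 0 < b \<and> r powr (1 / p) \<le> b} \<le> ennreal (r powr (1 / p)) + ennreal e"
          using \<open>0 < e\<close> by (intro Inf_lower) (simp flip: ennreal_plus)
      qed
      show "ennreal (r powr (1 / p)) \<le> Inf {ennreal b | b. 0 < b \<and> r powr (1 / p) \<le> b}"
        by (rule Inf_greatest) (auto intro: ennreal_leI)
    qed
    then show ?thesis
      unfolding orlicz_norm_def set using r by (simp add: Lp_norm_def)
  qed
qed

section \<open>Sequence modulars and comparison of norms\<close>

definition seq_modular :: "(ennreal \<Rightarrow> ennreal) \<Rightarrow> ('a \<Rightarrow> complex) \<Rightarrow> real \<Rightarrow> ennreal" where
  "seq_modular \<Phi> a b = (\<integral>\<^sup>+k. \<Phi> (ennreal (cmod (a k) / b)) \<partial>count_space UNIV)"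

lemma seq_modular_antimono:
  assumes "modular \<Phi>" "0 < b" "b \<le> b'"
  shows "seq_modular \<Phi> a b' \<le> seq_modular \<Phi> a b"
  unfolding seq_modular_def using assms
  by (intro nn_integral_mono modular_mono) (auto intro: divide_left_mono)

text \<open>The source of boundedness: if the modular is at most 1, then \<open>|a k| / b\<close>
  stays below any \<open>y\<close> with \<open>\<Phi> y > 1\<close>.\<close>

lemma le_seq_modular: "\<Phi> (ennreal (cmod (a k) / b)) \<le> seq_modular \<Phi> a b"
proof -
  have "\<Phi> (ennreal (cmod (a k) / b)) = (\<integral>\<^sup>+j. \<Phi> (ennreal (cmod (a j) / b)) * indicator {k} j \<partial>count_space UNIV)"
    by (subst nn_integral_indicator_singleton) auto
  also have "\<dots> \<le> seq_modular \<Phi> a b"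
    unfolding seq_modular_def by (intro nn_integral_mono) (auto simp: indicator_def)
  finally show ?thesis .
qed

definition window_mass :: "('a \<Rightarrow> complex) \<Rightarrow> real" where
  "window_mass g = (\<Sum>\<^sub>\<infinity>k. cmod (g k))"

lemma window_mass_pos:
  assumes "g \<in> schwartz" "g k0 \<noteq> 0"
  shows "0 < window_mass g"
proof -
  have "(\<Sum>k\<in>{k0}. cmod (g k)) \<le> window_mass g"
    unfolding window_mass_def by (intro finite_sum_le_infsum schwartz_summable assms) auto
  moreover have "0 < cmod (g k0)" using assms(2) by simp
  ultimately show ?thesis by (simp del: zero_less_norm_iff)
qed

lemma orlicz_norm_stft_le:
  assumes "modular \<Phi>" "f \<in> schwartz_dual" "g \<in> schwartz" "g k0 \<noteq> 0" "0 < \<eta>"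
    and "seq_modular \<Phi> (coef f) \<eta> \<le> 1"
  shows "orlicz_norm \<Phi> (stft g f) \<le> ennreal (2 * window_mass g * \<eta>)"
  unfolding orlicz_norm_def
proof (rule Inf_lower, intro CollectI exI conjI refl)
  have pos: "0 < window_mass g"
    by (rule window_mass_pos[OF assms(3,4)])
  then show "0 < 2 * window_mass g * \<eta>" using assms(5) by simp
  show "phase_integral (\<lambda>z. \<Phi> (ennreal (cmod (stft g f z) / (2 * window_mass g * \<eta>)))) \<le> 1"
    using phase_integral_le_nn_integral_coef[OF assms(1,2,3,5) window_mass_def pos] assms(6)
    unfolding seq_modular_def by (rule order_trans)
qed (rule refl)

text \<open>The infimum in the norm may fail to be attained, as it does for the zero function. A
  strict inequality still supplies an admissible scale below \<open>b\<close>, and the sequence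
  modular decreases as the scale grows.\<close>

lemma orlicz_norm_stft_lessD:
  assumes \<Phi>: "modular \<Phi>" and "f \<in> schwartz_dual" "g \<in> schwartz" "g k0 \<noteq> 0"
    and less: "orlicz_norm \<Phi> (stft g f) < ennreal b"
  shows "seq_modular \<Phi> (coef f) (2 * b / cmod (g k0)) \<le> 1"
proof -
  obtain b' where b': "0 < b'" "phase_integral (\<lambda>z. \<Phi> (ennreal (cmod (stft g f z) / b'))) \<le> 1"
      "ennreal b' < ennreal b"
    using less unfolding orlicz_norm_def Inf_less_iff by blast
  then have "b' < b" by (simp add: ennreal_less_iff)
  have "seq_modular \<Phi> (coef f) (2 * b / cmod (g k0)) \<le> seq_modular \<Phi> (coef f) (2 * b' / cmod (g k0))"
    using b' \<open>b' < b\<close> assms(4) by (intro seq_modular_antimono[OF \<Phi>]) (auto intro: divide_right_mono)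
  also have "\<dots> \<le> phase_integral (\<lambda>z. \<Phi> (ennreal (cmod (stft g f z) / b')))"
    using nn_integral_coef_le_phase_integral[OF \<Phi> assms(2,3) b'(1), of k0] by (simp add: seq_modular_def)
  finally show ?thesis using b'(2) by simp
qed

lemma seq_modular_compare:
  assumes \<Phi>: "modular \<Phi>" and \<Psi>: "modular \<Psi>" and "0 < x0"
    and le: "\<And>x. 0 \<le> x \<Longrightarrow> x \<le> x0 \<Longrightarrow> \<Psi> (ennreal x) \<le> ennreal C * \<Phi> (ennreal x)"
  obtains K where "0 < K" "\<And>(a :: 'a \<Rightarrow> complex) b. 0 < b \<Longrightarrow> seq_modular \<Phi> a b \<le> 1 \<Longrightarrow> seq_modular \<Psi> a (K * b) \<le> 1"
proof -
  obtain y where y: "0 < y" "1 < \<Phi> (ennreal y)"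
    using \<Phi> unfolding modular_def by blast
  \<comment> \<open>\<open>K \<ge> y / x0\<close> brings all terms, which are below \<open>y\<close>
    at scale \<open>b\<close>, into \<open>[0, x0]\<close>; \<open>K \<ge> C\<close> lets the factor
    \<open>1 / K\<close> gained from scaling cancel \<open>C\<close>; \<open>K \<ge> 1\<close> makes
    \<open>1 / K\<close> an admissible scaling factor.\<close>
  define K where "K = max 1 (max (y / x0) C)"
  have K: "1 \<le> K" "y / x0 \<le> K" "C \<le> K" by (auto simp: K_def)
  have "seq_modular \<Psi> a (K * b) \<le> 1" if "0 < b" "seq_modular \<Phi> a b \<le> 1" for a :: "'a \<Rightarrow> complex" and b
  proof -
    have "\<Psi> (ennreal (cmod (a k) / (K * b))) \<le> \<Phi> (ennreal (cmod (a k) / b))" for k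
    proof -
      have ky: "cmod (a k) / b < y"
      proof (rule ccontr)
        assume "\<not> cmod (a k) / b < y"
        then have "\<Phi> (ennreal y) \<le> \<Phi> (ennreal (cmod (a k) / b))"
          using y by (intro modular_mono[OF \<Phi>]) auto
        also have "\<dots> \<le> 1"
          using le_seq_modular that(2) by (rule order_trans)
        finally show False using y(2) by simp
      qed
      have "cmod (a k) / (K * b) = (cmod (a k) / b) / K"
        by (simp add: field_simps)
      also have "\<dots> \<le> y / K"
        using ky K by (intro divide_right_mono) auto
      also have "\<dots> \<le> x0"
        using K \<open>0 < x0\<close> by (simp add: field_simps)
      finally have "\<Psi> (ennreal (cmod (a k) / (K * b))) \<le> ennreal C * \<Phi> (ennreal (cmod (a k) / (K * b)))"
        using K that by (intro le) auto
      also have "cmod (a k) / (K * b) = 1 / K * (cmod (a k) / b)"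
        by (simp add: field_simps)
      also have "ennreal C * \<Phi> (ennreal (1 / K * (cmod (a k) / b))) \<le> ennreal K * (ennreal (1 / K) * \<Phi> (ennreal (cmod (a k) / b)))"
        using K that by (intro mult_mono ennreal_leI modular_scale[OF \<Phi>]) auto
      also have "\<dots> = \<Phi> (ennreal (cmod (a k) / b))"
        using K by (simp flip: mult.assoc ennreal_mult)
      finally show ?thesis by simp
    qed
    then have "seq_modular \<Psi> a (K * b) \<le> seq_modular \<Phi> a b"
      unfolding seq_modular_def by (intro nn_integral_mono)
    then show ?thesis using that(2) by simp
  qed
  then show ?thesis using that[of K] K by auto
qed

lemma orlicz_norm_stft_compare:
  assumes \<Phi>: "modular \<Phi>" and \<Psi>: "modular \<Psi>" and "0 < x0"
    and le: "\<And>x. 0 \<le> x \<Longrightarrow> x \<le> x0 \<Longrightarrow> \<Psi> (ennreal x) \<le> ennreal C * \<Phi> (ennreal x)"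
    and g: "g \<in> schwartz" "g k0 \<noteq> 0"
  obtains K where "0 < K"
    "\<And>f. f \<in> schwartz_dual \<Longrightarrow> orlicz_norm \<Psi> (stft g f) \<le> ennreal K * orlicz_norm \<Phi> (stft g f)"
proof -
  obtain K where K: "0 < K" "\<And>(a :: int^'a \<Rightarrow> complex) b. 0 < b \<Longrightarrow> seq_modular \<Phi> a b \<le> 1 \<Longrightarrow> seq_modular \<Psi> a (K * b) \<le> 1"
    using seq_modular_compare[OF \<Phi> \<Psi> \<open>0 < x0\<close> le] by blast
  \<comment> \<open>Three losses: \<open>2 / |g k0|\<close> from the transform to the coefficients,
    \<open>K\<close> from \<Phi> to \<Psi>, and twice the window mass on the way back.\<close>
  define L where "L = 2 * window_mass g * (K * (2 / cmod (g k0)))"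
  have "0 < L"
    using window_mass_pos[OF g] K(1) g(2) by (simp add: L_def)
  have "orlicz_norm \<Psi> (stft g f) \<le> ennreal L * orlicz_norm \<Phi> (stft g f)" if f: "f \<in> schwartz_dual" for f
  proof (cases "orlicz_norm \<Phi> (stft g f)")
    case (real r)
    have "orlicz_norm \<Psi> (stft g f) \<le> ennreal (L * r)"
    proof (rule ennreal_le_epsilon)
      fix e :: real assume "0 < e"
      \<comment> \<open>The excess is chosen to make \<open>L * b = L * r + e\<close>, and it
        provides the strict inequality that \<open>orlicz_norm_stft_lessD\<close> asks for.\<close>
      define b where "b = r + e / L"
      have b: "r < b" "0 < b" using \<open>0 < e\<close> \<open>0 < L\<close> real(1) by (simp_all add: b_def add_nonneg_pos)
      have "orlicz_norm \<Phi> (stft g f) < ennreal b"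
        using b real by (simp add: ennreal_less_iff)
      then have "seq_modular \<Phi> (coef f) (2 * b / cmod (g k0)) \<le> 1"
        by (rule orlicz_norm_stft_lessD[OF \<Phi> f g])
      then have "seq_modular \<Psi> (coef f) (K * (2 * b / cmod (g k0))) \<le> 1"
        using b g(2) by (intro K(2)) auto
      then have "orlicz_norm \<Psi> (stft g f) \<le> ennreal (2 * window_mass g * (K * (2 * b / cmod (g k0))))"
        using b g(2) K(1) by (intro orlicz_norm_stft_le[OF \<Psi> f g]) auto
      also have "2 * window_mass g * (K * (2 * b / cmod (g k0))) = L * b"
        by (simp add: L_def)
      also have "L * b = L * r + e"
        using \<open>0 < L\<close> by (simp add: b_def field_simps)
      finally show "orlicz_norm \<Psi> (stft g f) \<le> ennreal (L * r) + ennreal e"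
        using \<open>0 < L\<close> real(1) \<open>0 < e\<close> by (simp flip: ennreal_plus)
    qed
    then show ?thesis
      using real \<open>0 < L\<close> by (simp add: ennreal_mult)
  next
    case top
    then show ?thesis using \<open>0 < L\<close> by (simp add: ennreal_mult_top)
  qed
  then show ?thesis using that \<open>0 < L\<close> by blast
qed

section \<open>Modulation spaces as sequence spaces\<close>

text \<open>Membership becomes a condition on the coefficients, in which no window occurs;
  differences and truncations are handled through this criterion.\<close>

lemma modulation_space_orlicz_iff:
  assumes "modular \<Phi>" and g: "g \<in> schwartz" "g k0 \<noteq> 0"
  shows "f \<in> modulation_space (orlicz_norm \<Phi>) g \<longleftrightarrow>
    f \<in> schwartz_dual \<and> (\<exists>b>0. seq_modular \<Phi> (coef f) b \<le> 1)"
proof (cases "f \<in> schwartz_dual")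
  case f: True
  have "\<exists>b>0. seq_modular \<Phi> (coef f) b \<le> 1" if fin: "orlicz_norm \<Phi> (stft g f) < \<infinity>"
  proof -
    obtain r where r: "0 \<le> r" "orlicz_norm \<Phi> (stft g f) = ennreal r"
      using fin by (cases "orlicz_norm \<Phi> (stft g f)") auto
    then have "orlicz_norm \<Phi> (stft g f) < ennreal (r + 1)"
      by (simp add: ennreal_less_iff)
    from orlicz_norm_stft_lessD[OF assms(1) f g this] r(1) g(2) show ?thesis
      by (intro exI[of _ "2 * (r + 1) / cmod (g k0)"]) simp
  qed
  moreover have "orlicz_norm \<Phi> (stft g f) < \<infinity>" if "0 < b" "seq_modular \<Phi> (coef f) b \<le> 1" for b
    using orlicz_norm_stft_le[OF assms(1) f g that] by (rule le_less_trans) simp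
  ultimately show ?thesis
    using f by (auto simp: modulation_space_def)
qed (simp add: modulation_space_def)

section \<open>Differences of elements\<close>

lemma coef_diff: "coef (f1 - f2) k = coef f1 k - coef f2 k"
  by (simp add: coef_def)

lemma schwartz_dual_diff:
  assumes "f1 \<in> schwartz_dual" "f2 \<in> schwartz_dual"
  shows "f1 - f2 \<in> schwartz_dual"
  unfolding schwartz_dual_def
proof (intro CollectI conjI ballI allI impI)
  have "continuous_map schwartz_topology euclidean (\<lambda>\<phi>. f1 \<phi> - f2 \<phi>)"
    using assms by (intro continuous_map_diff) (auto simp: schwartz_dual_def)
  then show "continuous_map schwartz_topology euclidean (f1 - f2)"
    by (simp add: fun_diff_def)
qed (use assms in \<open>auto simp: schwartz_dual_def algebra_simps\<close>)

text \<open>A \<open>modular\<close> need not be convex, so the larger of the two arguments takes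
  the place of their mean. Of the factor 4, one 2 bounds the mean by the maximum and the other gives
  the \<open>1 / 2\<close> in front of the sum of the two modulars.\<close>

lemma seq_modular_diff:
  assumes \<Phi>: "modular \<Phi>" and b: "0 < b" and le: "seq_modular \<Phi> a1 b \<le> 1" "seq_modular \<Phi> a2 b \<le> 1"
  shows "seq_modular \<Phi> (\<lambda>k. a1 k - a2 k) (4 * b) \<le> 1"
proof -
  have pt: "\<Phi> (ennreal (cmod (a1 k - a2 k) / (4 * b)))
      \<le> ennreal (1 / 2) * (\<Phi> (ennreal (cmod (a1 k) / b)) + \<Phi> (ennreal (cmod (a2 k) / b)))" for k
  proof -
    define u where "u = max (cmod (a1 k) / b) (cmod (a2 k) / b)"
    have u: "0 \<le> u" using b by (simp add: u_def le_max_iff_disj)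
    have "cmod (a1 k - a2 k) / (4 * b) \<le> (cmod (a1 k) / b + cmod (a2 k) / b) / 4"
      using norm_triangle_ineq4[of "a1 k" "a2 k"] b by (simp add: field_simps)
    also have "\<dots> \<le> 1 / 2 * u"
    proof -
      have "(x + y) / 4 \<le> 1 / 2 * max x y" for x y :: real
        by (auto simp: max_def)
      then show ?thesis unfolding u_def .
    qed
    finally have "\<Phi> (ennreal (cmod (a1 k - a2 k) / (4 * b))) \<le> \<Phi> (ennreal (1 / 2 * u))"
      using b by (intro modular_mono[OF \<Phi>]) auto
    also have "\<dots> \<le> ennreal (1 / 2) * \<Phi> (ennreal u)"
      by (intro modular_scale[OF \<Phi>] u) auto
    also have "\<Phi> (ennreal u) \<le> \<Phi> (ennreal (cmod (a1 k) / b)) + \<Phi> (ennreal (cmod (a2 k) / b))"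
      by (simp add: u_def max_def add_increasing add_increasing2)
    finally show ?thesis by (simp add: mult_left_mono)
  qed
  have "seq_modular \<Phi> (\<lambda>k. a1 k - a2 k) (4 * b) \<le> ennreal (1 / 2) * (seq_modular \<Phi> a1 b + seq_modular \<Phi> a2 b)"
    unfolding seq_modular_def
    by (subst nn_integral_add[symmetric], simp, simp, subst nn_integral_cmult[symmetric], simp)
      (intro nn_integral_mono pt)
  also have "\<dots> \<le> ennreal (1 / 2) * (1 + 1)"
    by (intro mult_left_mono add_mono le) auto
  also have "\<dots> = 1"
    by (metis ennreal_1 ennreal_mult ennreal_plus field_sum_of_halves mult.right_neutral distrib_left
        zero_le_one divide_nonneg_nonneg zero_le_numeral)
  finally show ?thesis .
qed

text \<open>The topology measures \<open>y - x\<close> by \<open>enn2real\<close> of a norm, and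
  \<open>enn2real\<close> turns an infinite norm into 0. Estimates between two such values are
  meaningful once differences are known to stay in the space.\<close>

lemma modulation_space_diff:
  assumes "modular \<Phi>" and g: "g \<in> schwartz" "g k0 \<noteq> 0"
    and "f1 \<in> modulation_space (orlicz_norm \<Phi>) g" "f2 \<in> modulation_space (orlicz_norm \<Phi>) g"
  shows "f1 - f2 \<in> modulation_space (orlicz_norm \<Phi>) g"
proof -
  note iff = modulation_space_orlicz_iff[OF assms(1) g]
  obtain b1 where b1: "0 < b1" "seq_modular \<Phi> (coef f1) b1 \<le> 1" using assms(4) iff by blast
  obtain b2 where b2: "0 < b2" "seq_modular \<Phi> (coef f2) b2 \<le> 1" using assms(5) iff by blast
  have "seq_modular \<Phi> (coef f1) (max b1 b2) \<le> 1" "seq_modular \<Phi> (coef f2) (max b1 b2) \<le> 1"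
    using b1 b2 by (auto intro: order_trans[OF seq_modular_antimono[OF assms(1)]])
  from seq_modular_diff[OF assms(1) _ this] b1(1)
  have "seq_modular \<Phi> (coef (f1 - f2)) (4 * max b1 b2) \<le> 1"
    by (simp add: coef_diff[abs_def] less_max_iff_disj)
  moreover have "f1 - f2 \<in> schwartz_dual"
    using assms(4,5) by (intro schwartz_dual_diff) (auto simp: modulation_space_def)
  ultimately show ?thesis
    unfolding iff using b1(1) by (intro conjI exI[of _ "4 * max b1 b2"]) auto
qed

section \<open>Truncations and their approximation properties\<close>

definition restrict_dual ::
    "(int^'n) set \<Rightarrow> ((int^'n \<Rightarrow> complex) \<Rightarrow> complex) \<Rightarrow> (int^'n \<Rightarrow> complex) \<Rightarrow> complex" where
  "restrict_dual S f \<phi> = (if \<phi> \<in> schwartz then \<Sum>k\<in>S. coef f k * \<phi> k else 0)"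

lemma coef_restrict_dual:
  assumes "finite S"
  shows "coef (restrict_dual S f) k = (if k \<in> S then coef f k else 0)"
proof -
  have "(\<lambda>l. if l = k then 1 else 0) \<in> schwartz"
    by (rule finite_support_schwartz) simp
  then have "coef (restrict_dual S f) k = (\<Sum>l\<in>S. coef f l * (if l = k then 1 else 0))"
    by (simp add: coef_def[of "restrict_dual S f"] restrict_dual_def)
  also have "\<dots> = (if k \<in> S then coef f k else 0)"
    using assms by (simp add: if_distrib[of "\<lambda>x. _ * x"] cong: if_cong)
  finally show ?thesis .
qed

text \<open>A finite combination of point evaluations is controlled by the seminorm of order 0
  alone.\<close>

lemma restrict_dual_schwartz_dual:
  fixes S :: "(int^'n) set"
  assumes "finite S"
  shows "restrict_dual S f \<in> schwartz_dual"
proof -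
  let ?h = "restrict_dual S f"
  have "openin schwartz_topology {\<phi> \<in> schwartz. ?h \<phi> \<in> U}" if "open U" for U
    unfolding schwartz_topology_def openin_seminorm_topology
  proof (intro conjI ballI)
    fix \<phi> assume \<phi>: "\<phi> \<in> {\<phi> \<in> schwartz. ?h \<phi> \<in> U}"
    then obtain e where e: "0 < e" "ball (?h \<phi>) e \<subseteq> U"
      using \<open>open U\<close> by (auto simp: open_contains_ball)
    \<comment> \<open>The added 1 keeps \<open>B\<close> positive when all coefficients in
      \<open>S\<close> vanish, so that \<open>e / B\<close> is a genuine radius.\<close>
    define B where "B = (\<Sum>k\<in>S. cmod (coef f k)) + 1"
    have B: "0 < B" by (simp add: B_def add_nonneg_pos sum_nonneg)
    have "?h \<psi> \<in> U" if \<psi>: "\<psi> \<in> schwartz" "schwartz_seminorm 0 (\<psi> - \<phi>) < e / B" for \<psi>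
    proof -
      have d: "\<psi> - \<phi> \<in> schwartz" using \<psi> \<phi> by (auto intro: schwartz_diff)
      have N: "cmod ((\<psi> - \<phi>) k) \<le> schwartz_seminorm 0 (\<psi> - \<phi>)" for k
        using le_schwartz_seminorm[OF d, of k 0] by simp
      then have N0: "0 \<le> schwartz_seminorm 0 (\<psi> - \<phi>)"
        by (rule order_trans[rotated]) simp
      have "?h \<psi> - ?h \<phi> = (\<Sum>k\<in>S. coef f k * (\<psi> - \<phi>) k)"
        using \<psi> \<phi> by (simp add: restrict_dual_def algebra_simps sum_subtractf)
      also have "cmod \<dots> \<le> (\<Sum>k\<in>S. cmod (coef f k) * schwartz_seminorm 0 (\<psi> - \<phi>))"
        using N by (intro sum_norm_le) (auto simp: norm_mult intro: mult_left_mono)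
      also have "\<dots> \<le> B * schwartz_seminorm 0 (\<psi> - \<phi>)"
        using N0 by (simp add: B_def sum_distrib_right ring_distribs)
      also have "\<dots> < e"
        using \<psi>(2) B by (simp add: field_simps)
      finally show ?thesis using e(2) by (auto simp: dist_norm norm_minus_commute subset_iff)
    qed
    then show "\<exists>J e. finite J \<and> 0 < e \<and>
        {y \<in> schwartz. \<forall>j\<in>J. schwartz_seminorm j (y - \<phi>) < e} \<subseteq> {\<phi> \<in> schwartz. ?h \<phi> \<in> U}"
      using e(1) B by (intro exI[of _ "{0}"] exI[of _ "e / B"]) auto
  qed auto
  then have "continuous_map schwartz_topology euclidean ?h"
    by (simp add: continuous_map_def schwartz_topology_def)
  moreover have "?h (\<lambda>k. a * \<phi> k + b * \<psi> k) = a * ?h \<phi> + b * ?h \<psi>"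
    if "\<phi> \<in> schwartz" "\<psi> \<in> schwartz" for \<phi> \<psi> a b
    using that schwartz_combination[OF that]
    by (simp add: restrict_dual_def algebra_simps sum.distrib sum_distrib_left)
  ultimately show ?thesis
    by (simp add: schwartz_dual_def restrict_dual_def)
qed

text \<open>This is where finiteness of \<Phi> at some positive point enters: a scale that pushes
  every term below \<open>t * y\<close> bounds each summand by \<open>t * \<Phi> y\<close>, and
  \<open>t\<close> is taken so small that the finitely many summands add up to at most 1.\<close>

lemma seq_modular_finite_support:
  fixes a :: "'a \<Rightarrow> complex"
  assumes \<Phi>: "modular \<Phi>" and S: "finite S" "\<And>k. k \<notin> S \<Longrightarrow> a k = 0"
  shows "\<exists>b>0. seq_modular \<Phi> a b \<le> 1"
proof -
  obtain y where y: "0 < y" "\<Phi> (ennreal y) < \<infinity>"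
    using \<Phi> unfolding modular_def by blast
  then obtain c where c: "0 \<le> c" "\<Phi> (ennreal y) = ennreal c"
    by (cases "\<Phi> (ennreal y)") auto
  define A where "A = (\<Sum>k\<in>S. cmod (a k)) + 1"
  have A: "1 \<le> A" "cmod (a k) \<le> A" for k
  proof -
    show "1 \<le> A" by (simp add: A_def sum_nonneg)
    show "cmod (a k) \<le> A"
      using member_le_sum[of k S "\<lambda>k. cmod (a k)"] S \<open>1 \<le> A\<close>
      by (cases "k \<in> S") (auto simp: A_def)
  qed
  define t where "t = 1 / (real (card S) * c + 1)"
  have t: "0 < t" "t \<le> 1"
    using c(1) by (auto simp: t_def add_nonneg_pos)
  have small: "\<Phi> (ennreal (cmod (a k) / (A / (t * y)))) \<le> ennreal (t * c)" for k
  proof -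
    have "cmod (a k) / (A / (t * y)) \<le> t * y"
      using A(1) A(2)[of k] t y by (simp add: field_simps mult_left_mono)
    then have "\<Phi> (ennreal (cmod (a k) / (A / (t * y)))) \<le> \<Phi> (ennreal (t * y))"
      using A(1) t y by (intro modular_mono[OF \<Phi>]) auto
    also have "\<dots> \<le> ennreal t * \<Phi> (ennreal y)"
      using t y by (intro modular_scale[OF \<Phi>]) auto
    finally show ?thesis using c t by (simp add: ennreal_mult)
  qed
  have "seq_modular \<Phi> a (A / (t * y)) \<le> (\<integral>\<^sup>+k. ennreal (t * c) * indicator S k \<partial>count_space UNIV)"
    unfolding seq_modular_def
    using small S(2) modular_0[OF \<Phi>] by (intro nn_integral_mono) (auto simp: indicator_def)
  also have "\<dots> = ennreal (t * c) * ennreal (real (card S))"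
    using S(1) by (simp add: nn_integral_cmult ennreal_of_nat_eq_real_of_nat)
  also have "\<dots> = ennreal (t * c * real (card S))"
    using t c by (simp add: ennreal_mult)
  also have "\<dots> \<le> 1"
  proof -
    have "0 \<le> real (card S) * c" using c(1) by simp
    then have "t * c * real (card S) \<le> 1"
      by (simp add: t_def divide_le_eq_1 mult.commute)
    then show ?thesis by simp
  qed
  finally show ?thesis
    using A(1) t y by (intro exI[of _ "A / (t * y)"]) auto
qed

text \<open>A finite integral over the counting measure has finite values everywhere, so it is an
  unconditionally convergent real sum, whose partial sums approach the total.\<close>

lemma nn_integral_count_space_tail:
  fixes u :: "'a \<Rightarrow> ennreal"
  assumes fin: "(\<integral>\<^sup>+k. u k \<partial>count_space UNIV) < \<infinity>" and "0 < \<epsilon>"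
  obtains S where "finite S" "(\<integral>\<^sup>+k. (if k \<in> S then 0 else u k) \<partial>count_space UNIV) \<le> ennreal \<epsilon>"
proof -
  define r where "r k = enn2real (u k)" for k
  have "u k \<noteq> \<infinity>" for k
    using nn_integral_noteq_infinite[of u "count_space UNIV"] fin by (auto simp: AE_count_space)
  then have u: "u k = ennreal (r k)" for k
    by (simp add: r_def less_top)
  have r0: "0 \<le> r k" for k by (simp add: r_def)
  have "integrable (count_space UNIV) r"
    using fin by (intro integrableI_nonneg) (auto simp: u r0)
  then have sum: "r summable_on UNIV"
    using abs_summable_equivalent[of r UNIV] r0 by (simp add: Infinite_Set_Sum.abs_summable_on_def)
  then have "(r has_sum infsum r UNIV) UNIV" by simp
  then have "\<forall>\<^sub>F S in finite_subsets_at_top UNIV. dist (sum r S) (infsum r UNIV) < \<epsilon>"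
    unfolding has_sum_def using \<open>0 < \<epsilon>\<close> by (rule tendstoD)
  then obtain S where S: "finite S" "dist (sum r S) (infsum r UNIV) < \<epsilon>"
    by (auto simp: eventually_finite_subsets_at_top)
  have "r summable_on - S"
    using sum by (rule summable_on_subset) auto
  have "(\<integral>\<^sup>+k. (if k \<in> S then 0 else u k) \<partial>count_space UNIV) = (\<integral>\<^sup>+k. ennreal (if k \<in> S then 0 else r k) \<partial>count_space UNIV)"
    by (intro nn_integral_cong) (auto simp: u)
  also have "\<dots> = ennreal (\<Sum>\<^sub>\<infinity>k. if k \<in> S then 0 else r k)"
    using sum by (intro nn_integral_count_space_infsum) (auto simp: r0 intro: summable_on_comparison_test)
  also have "(\<Sum>\<^sub>\<infinity>k. if k \<in> S then 0 else r k) = infsum r (- S)"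
    by (intro infsum_cong_neutral) auto
  also have "infsum r (- S) = infsum r UNIV - sum r S"
    using infsum_Un_disjoint[of r S "- S"] S(1) \<open>r summable_on - S\<close> by simp
  also have "\<dots> \<le> \<epsilon>"
    using S(2) by (simp add: dist_real_def)
  finally show ?thesis using that S(1) by (simp add: ennreal_leI)
qed

text \<open>The modular is controlled at scale \<open>b\<close>, while the tail must be small at the
  possibly much finer scale \<eta>. If \<open>2^N > b / \<eta>\<close>, then \<open>N\<close>
  doublings bound the terms at scale \<eta> by \<open>E^N\<close> times those at scale
  \<open>b\<close>. This works for terms so small that the doublings stay in \<open>[0, x0]\<close>;
  the others are finitely many, since each adds at least a fixed positive amount to a finite
  modular.\<close>

lemma seq_modular_tail:
  fixes a :: "'a \<Rightarrow> complex"
  assumes \<Psi>: "modular \<Psi>" and "0 < x0"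
    and doubling: "\<And>x. 0 \<le> x \<Longrightarrow> x \<le> x0 \<Longrightarrow> \<Psi> (ennreal (2 * x)) \<le> ennreal D * \<Psi> (ennreal x)"
    and pos: "\<And>x. 0 < x \<Longrightarrow> 0 < \<Psi> (ennreal x)"
    and b: "0 < b" "seq_modular \<Psi> a b \<le> 1" and "0 < \<eta>"
  obtains S where "finite S" "seq_modular \<Psi> (\<lambda>k. if k \<in> S then 0 else a k) \<eta> \<le> 1"
proof -
  \<comment> \<open>\<open>D\<close> is an arbitrary real; the maximum makes the constant positive,
    so that \<open>1 / E ^ N\<close> can serve as a tolerance.\<close>
  define E where "E = max 1 D"
  have E: "1 \<le> E" and dbl: "\<And>x. 0 \<le> x \<Longrightarrow> x \<le> x0 \<Longrightarrow> \<Psi> (ennreal (2 * x)) \<le> ennreal E * \<Psi> (ennreal x)"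
  proof -
    show "1 \<le> E" by (simp add: E_def)
    fix x assume "0 \<le> x" "x \<le> x0"
    then have "\<Psi> (ennreal (2 * x)) \<le> ennreal D * \<Psi> (ennreal x)" by (rule doubling)
    also have "\<dots> \<le> ennreal E * \<Psi> (ennreal x)"
      by (intro mult_right_mono ennreal_leI) (auto simp: E_def)
    finally show "\<Psi> (ennreal (2 * x)) \<le> ennreal E * \<Psi> (ennreal x)" .
  qed
  have iter: "0 \<le> x \<Longrightarrow> 2 ^ n * x \<le> x0 \<Longrightarrow> \<Psi> (ennreal (2 ^ n * x)) \<le> ennreal (E ^ n) * \<Psi> (ennreal x)" for n x
  proof (induction n)
    case (Suc n)
    then have le: "2 ^ n * x \<le> x0"
    proof -
      have "0 \<le> 2 ^ n * x" using Suc.prems(1) by simp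
      moreover have "2 ^ Suc n * x = 2 * (2 ^ n * x)" by simp
      ultimately show ?thesis using Suc.prems(2) by linarith
    qed
    have "\<Psi> (ennreal (2 ^ Suc n * x)) = \<Psi> (ennreal (2 * (2 ^ n * x)))"
      by (simp add: mult.assoc)
    also have "\<dots> \<le> ennreal E * \<Psi> (ennreal (2 ^ n * x))"
      using le Suc.prems(1) by (intro dbl) auto
    also have "\<dots> \<le> ennreal E * (ennreal (E ^ n) * \<Psi> (ennreal x))"
      using le Suc by (intro mult_left_mono) auto
    also have "\<dots> = ennreal (E ^ Suc n) * \<Psi> (ennreal x)"
      using E by (simp add: ennreal_mult mult.assoc)
    finally show ?case .
  qed simp
  obtain N :: nat where N: "b / \<eta> < 2 ^ N"
    using real_arch_pow[of 2 "b / \<eta>"] by auto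
  \<comment> \<open>Below this threshold, \<open>N\<close> successive doublings do not leave
    \<open>[0, x0]\<close>.\<close>
  define y where "y = x0 / 2 ^ N"
  have "0 < y" using \<open>0 < x0\<close> by (simp add: y_def)
  let ?u = "\<lambda>k. \<Psi> (ennreal (cmod (a k) / b))"
  have fin: "(\<integral>\<^sup>+k. ?u k \<partial>count_space UNIV) < \<infinity>"
    using b(2) unfolding seq_modular_def by (rule le_less_trans) simp
  define S0 where "S0 = {k. y \<le> cmod (a k) / b}"
  have "finite S0"
  proof (rule ccontr)
    assume inf: "infinite S0"
    have "(\<integral>\<^sup>+k. \<Psi> (ennreal y) * indicator S0 k \<partial>count_space UNIV) \<le> (\<integral>\<^sup>+k. ?u k \<partial>count_space UNIV)"
      using \<open>0 < y\<close> by (intro nn_integral_mono) (auto simp: S0_def indicator_def intro: modular_mono[OF \<Psi>])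
    also note fin
    finally show False
      using inf pos[OF \<open>0 < y\<close>] by (auto simp: nn_integral_cmult ennreal_mult_top split: if_splits)
  qed
  have "0 < 1 / E ^ N" using E by simp
  then obtain S1 where S1: "finite S1"
    "(\<integral>\<^sup>+k. (if k \<in> S1 then 0 else ?u k) \<partial>count_space UNIV) \<le> ennreal (1 / E ^ N)"
    by (rule nn_integral_count_space_tail[OF fin])
  let ?S = "S0 \<union> S1"
  have pt: "\<Psi> (ennreal (cmod (if k \<in> ?S then 0 else a k) / \<eta>)) \<le> ennreal (E ^ N) * (if k \<in> S1 then 0 else ?u k)" for k
  proof (cases "k \<in> ?S")
    case True
    then show ?thesis using modular_0[OF \<Psi>] by simp
  next
    case False
    then have small: "2 ^ N * (cmod (a k) / b) \<le> x0"
      by (simp add: S0_def y_def field_simps not_le)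
    have "cmod (a k) / \<eta> = b / \<eta> * (cmod (a k) / b)"
      using b(1) by simp
    also have "\<dots> \<le> 2 ^ N * (cmod (a k) / b)"
      using N b(1) by (intro mult_right_mono) auto
    finally have "\<Psi> (ennreal (cmod (a k) / \<eta>)) \<le> \<Psi> (ennreal (2 ^ N * (cmod (a k) / b)))"
      using \<open>0 < \<eta>\<close> by (intro modular_mono[OF \<Psi>]) auto
    also have "\<dots> \<le> ennreal (E ^ N) * ?u k"
      using small b(1) by (intro iter) auto
    finally show ?thesis using False by simp
  qed
  have "seq_modular \<Psi> (\<lambda>k. if k \<in> ?S then 0 else a k) \<eta>
      \<le> (\<integral>\<^sup>+k. ennreal (E ^ N) * (if k \<in> S1 then 0 else ?u k) \<partial>count_space UNIV)"
    unfolding seq_modular_def by (intro nn_integral_mono pt)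
  also have "\<dots> = ennreal (E ^ N) * (\<integral>\<^sup>+k. (if k \<in> S1 then 0 else ?u k) \<partial>count_space UNIV)"
    by (rule nn_integral_cmult) simp
  also have "\<dots> \<le> ennreal (E ^ N) * ennreal (1 / E ^ N)"
    by (intro mult_left_mono S1) simp
  also have "\<dots> = 1"
    using E by (simp flip: ennreal_mult)
  finally show ?thesis
    using that[of ?S] \<open>finite S0\<close> S1(1) by simp
qed

text \<open>The comparison \<open>le\<close> yields the inclusion and its continuity. Density uses
  doubling and positivity of the target \<Psi> only: truncations lie in the space of every modular,
  so they belong to the smaller space without any growth condition on \<Phi>.\<close>

lemma modulation_continuous_dense_inclusion:
  assumes \<Phi>: "modular \<Phi>" and \<Psi>: "modular \<Psi>" and "0 < x0"
    and le: "\<And>x. 0 \<le> x \<Longrightarrow> x \<le> x0 \<Longrightarrow> \<Psi> (ennreal x) \<le> ennreal C * \<Phi> (ennreal x)"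
    and doubling: "\<And>x. 0 \<le> x \<Longrightarrow> x \<le> x0 \<Longrightarrow> \<Psi> (ennreal (2 * x)) \<le> ennreal D * \<Psi> (ennreal x)"
    and pos: "\<And>x. 0 < x \<Longrightarrow> 0 < \<Psi> (ennreal x)"
    and g: "g \<in> schwartz" "g k0 \<noteq> 0"
  shows "continuous_dense_inclusion
    (modulation_topology (orlicz_norm \<Phi>) g) (modulation_topology (orlicz_norm \<Psi>) g)"
proof -
  let ?X = "modulation_space (orlicz_norm \<Phi>) g" and ?Y = "modulation_space (orlicz_norm \<Psi>) g"
  let ?N = "\<lambda>\<Phi> f. enn2real (orlicz_norm \<Phi> (stft g f))"
  obtain K where K: "0 < K"
    "\<And>f. f \<in> schwartz_dual \<Longrightarrow> orlicz_norm \<Psi> (stft g f) \<le> ennreal K * orlicz_norm \<Phi> (stft g f)"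
    using orlicz_norm_stft_compare[OF \<Phi> \<Psi> \<open>0 < x0\<close> le g] by blast
  have sub: "?X \<subseteq> ?Y"
  proof
    fix f assume f: "f \<in> ?X"
    then have "ennreal K * orlicz_norm \<Phi> (stft g f) < \<infinity>"
      by (simp add: modulation_space_def ennreal_mult_less_top)
    with f K(2)[of f] show "f \<in> ?Y"
      by (auto simp: modulation_space_def intro: le_less_trans)
  qed
  have N_le: "?N \<Psi> f \<le> K * ?N \<Phi> f" if "f \<in> ?X" for f
  proof -
    have fin: "ennreal K * orlicz_norm \<Phi> (stft g f) < \<infinity>"
      using that by (simp add: modulation_space_def ennreal_mult_less_top)
    have "?N \<Psi> f \<le> enn2real (ennreal K * orlicz_norm \<Phi> (stft g f))"
      using K(2)[of f] that fin by (intro enn2real_mono) (auto simp: modulation_space_def)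
    then show ?thesis using K(1) by (simp add: enn2real_mult)
  qed
  have "continuous_map (modulation_topology (orlicz_norm \<Phi>) g) (modulation_topology (orlicz_norm \<Psi>) g) id"
    unfolding continuous_map_def modulation_topology_def topspace_seminorm_topology
  proof (intro conjI allI impI)
    fix U assume "openin (seminorm_topology ?Y (\<lambda>_::unit. ?N \<Psi>)) U"
    then have U: "\<And>x. x \<in> U \<Longrightarrow> \<exists>J e. finite J \<and> 0 < e \<and> {y \<in> ?Y. \<forall>j::unit\<in>J. ?N \<Psi> (y - x) < e} \<subseteq> U"
      unfolding openin_seminorm_topology by blast
    show "openin (seminorm_topology ?X (\<lambda>_::unit. ?N \<Phi>)) {x \<in> ?X. id x \<in> U}"
      unfolding openin_seminorm_topology
    proof (intro conjI ballI)
      fix x assume x: "x \<in> {x \<in> ?X. id x \<in> U}"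
      \<comment> \<open>The index set \<open>J\<close> is empty or \<open>{()}\<close>; in both
        cases the ball of radius \<open>e\<close> is contained in the basic neighbourhood.\<close>
      then obtain J :: "unit set" and e where e: "0 < e" "{y \<in> ?Y. \<forall>j\<in>J. ?N \<Psi> (y - x) < e} \<subseteq> U"
        using U[of x] by auto
      have "y \<in> U" if y: "y \<in> ?X" "?N \<Phi> (y - x) < e / K" for y
      proof -
        have "?N \<Psi> (y - x) \<le> K * ?N \<Phi> (y - x)"
          using x y by (intro N_le modulation_space_diff[OF \<Phi> g]) auto
        also have "\<dots> < e" using y(2) K(1) by (simp add: field_simps)
        finally show ?thesis using e(2) y(1) sub by auto
      qed
      then show "\<exists>J e. finite J \<and> 0 < e \<and> {y \<in> ?X. \<forall>j::unit\<in>J. ?N \<Phi> (y - x) < e} \<subseteq> {x \<in> ?X. id x \<in> U}"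
        using e(1) K(1) by (intro exI[of _ "{()}"] exI[of _ "e / K"]) auto
    qed auto
  qed (use sub in auto)
  moreover have "?Y \<subseteq> modulation_topology (orlicz_norm \<Psi>) g closure_of ?X"
  proof
    fix f assume f: "f \<in> ?Y"
    then obtain b where b: "0 < b" "seq_modular \<Psi> (coef f) b \<le> 1" and fd: "f \<in> schwartz_dual"
      using modulation_space_orlicz_iff[OF \<Psi> g] by blast
    have "\<exists>h\<in>?X. h \<in> U" if U: "f \<in> U" "openin (modulation_topology (orlicz_norm \<Psi>) g) U" for U
    proof -
      obtain J :: "unit set" and e where e: "0 < e" "{y \<in> ?Y. \<forall>j\<in>J. ?N \<Psi> (y - f) < e} \<subseteq> U"
        using U unfolding modulation_topology_def openin_seminorm_topology by blast
      \<comment> \<open>With this scale the bound \<open>2 * window_mass g * \<eta>\<close> from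
        \<open>orlicz_norm_stft_le\<close> equals \<open>e / 2\<close>.\<close>
      define \<eta> where "\<eta> = e / (4 * window_mass g)"
      have G: "0 < window_mass g" by (rule window_mass_pos[OF g])
      then have "0 < \<eta>" using e(1) by (simp add: \<eta>_def)
      obtain S where S: "finite S" "seq_modular \<Psi> (\<lambda>k. if k \<in> S then 0 else coef f k) \<eta> \<le> 1"
        using seq_modular_tail[OF \<Psi> \<open>0 < x0\<close> doubling pos b \<open>0 < \<eta>\<close>] by blast
      let ?h = "restrict_dual S f"
      have hd: "?h \<in> schwartz_dual" by (rule restrict_dual_schwartz_dual[OF S(1)])
      have hX: "?h \<in> ?X"
        unfolding modulation_space_orlicz_iff[OF \<Phi> g]
        using hd S(1) by (auto intro!: seq_modular_finite_support[OF \<Phi> S(1)] simp: coef_restrict_dual)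
      \<comment> \<open>The difference is minus the tail of \<open>f\<close>; the modular sees
        absolute values only.\<close>
      have "cmod (coef (?h - f) k) = cmod (if k \<in> S then 0 else coef f k)" for k
        by (simp add: coef_diff coef_restrict_dual[OF S(1)])
      then have "seq_modular \<Psi> (coef (?h - f)) \<eta> \<le> 1"
        using S(2) by (simp add: seq_modular_def)
      then have "orlicz_norm \<Psi> (stft g (?h - f)) \<le> ennreal (2 * window_mass g * \<eta>)"
        using hd fd \<open>0 < \<eta>\<close> by (intro orlicz_norm_stft_le[OF \<Psi> _ g] schwartz_dual_diff)
      then have "?N \<Psi> (?h - f) \<le> 2 * window_mass g * \<eta>"
        using G \<open>0 < \<eta>\<close> by (intro enn2real_leI) auto
      also have "\<dots> < e" using G e(1) by (simp add: \<eta>_def)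
      finally show ?thesis using e(2) hX sub by auto
    qed
    then show "f \<in> modulation_topology (orlicz_norm \<Psi>) g closure_of ?X"
      using f by (auto simp: in_closure_of modulation_topology_def)
  qed
  ultimately show ?thesis
    using sub closure_of_subset_topspace[of "modulation_topology (orlicz_norm \<Psi>) g" ?X]
    by (auto simp: continuous_dense_inclusion_def modulation_topology_def)
qed

section \<open>Lebesgue exponents and Young functions\<close>

text \<open>Agreement is asked only on differences of elements because the Lebesgue and Luxemburg
  norms are identified only on transforms of dual elements, whose measurability is known.\<close>

lemma seminorm_topology_cong:
  assumes "\<And>x y j. x \<in> X \<Longrightarrow> y \<in> X \<Longrightarrow> N j (y - x) = N' j (y - x)"
  shows "seminorm_topology X N = seminorm_topology X N'"
proof (rule topology_eq[THEN iffD2], rule allI)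
  fix U
  have "{y \<in> X. \<forall>j\<in>J. N j (y - x) < e} = {y \<in> X. \<forall>j\<in>J. N' j (y - x) < e}" if "x \<in> X" for x J e
    using assms that by auto
  then have "(\<exists>J e. finite J \<and> 0 < e \<and> {y \<in> X. \<forall>j\<in>J. N j (y - x) < e} \<subseteq> U) \<longleftrightarrow>
      (\<exists>J e. finite J \<and> 0 < e \<and> {y \<in> X. \<forall>j\<in>J. N' j (y - x) < e} \<subseteq> U)" if "x \<in> X" for x
    using that by presburger
  then show "openin (seminorm_topology X N) U = openin (seminorm_topology X N') U"
    unfolding openin_seminorm_topology by (meson subsetD)
qed

lemma modulation_Lp_eq_orlicz:
  assumes "0 < p" and g: "g \<in> schwartz"
  shows "modulation_space (Lp_norm p) g = modulation_space (orlicz_norm (power_modular p)) g"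
    and "modulation_topology (Lp_norm p) g = modulation_topology (orlicz_norm (power_modular p)) g"
proof -
  have norm: "Lp_norm p (stft g f) = orlicz_norm (power_modular p) (stft g f)" if "f \<in> schwartz_dual" for f
    using assms that by (intro Lp_norm_eq_orlicz_norm stft_measurable)
  then show space: "modulation_space (Lp_norm p) g = modulation_space (orlicz_norm (power_modular p)) g"
    by (auto simp: modulation_space_def)
  show "modulation_topology (Lp_norm p) g = modulation_topology (orlicz_norm (power_modular p)) g"
    unfolding modulation_topology_def space
    by (rule seminorm_topology_cong) (auto simp: modulation_space_def norm schwartz_dual_diff)
qed

text \<open>Scaling is convexity between \<open>x\<close> and 0; a value above 1 comes from the
  limit at infinity.\<close>

lemma young_function_modular:
  assumes Y: "young_function \<Phi>" and fin: "0 < c" "\<Phi> (ennreal c) < \<infinity>"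
  shows "modular \<Phi>"
  unfolding modular_def
proof (intro conjI allI impI)
  fix t x :: real assume tx: "0 \<le> t" "t \<le> 1" "0 \<le> x"
  have "\<Phi> (ennreal t * ennreal x + ennreal (1 - t) * 0) \<le> ennreal t * \<Phi> (ennreal x) + ennreal (1 - t) * \<Phi> 0"
    using Y tx unfolding young_function_def by (meson atLeastAtMost_iff)
  moreover have "\<Phi> 0 = 0" using Y by (simp add: young_function_def)
  ultimately show "\<Phi> (ennreal (t * x)) \<le> ennreal t * \<Phi> (ennreal x)"
    using tx by (simp add: ennreal_mult)
next
  have "((\<lambda>t::real. \<Phi> (ennreal t)) \<longlongrightarrow> \<infinity>) at_top"
    using Y by (simp add: young_function_def)
  then have "\<forall>\<^sub>F t in at_top. 1 < \<Phi> (ennreal t)"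
    by (rule order_tendstoD) simp
  with eventually_gt_at_top[of 0] have "\<forall>\<^sub>F t::real in at_top. 0 < t \<and> 1 < \<Phi> (ennreal t)"
    by eventually_elim simp
  then show "\<exists>y>0. 1 < \<Phi> (ennreal y)"
    by (rule eventually_happens'[OF trivial_limit_at_top_linorder])
qed (use fin in blast)

text \<open>The inequality \<open>ln z <= z^a / a\<close> at \<open>z = 1 / x\<close> with
  \<open>a = 2 - p\<close>, the exponent that leaves exactly \<open>x^p\<close> after multiplication
  by \<open>x^2\<close>.\<close>

lemma square_log_le_powr:
  fixes x p :: real
  assumes "0 \<le> x" "x \<le> 1" "p < 2"
  shows "- (x\<^sup>2 * ln x) \<le> 1 / (2 - p) * x powr p"
proof (cases "x = 0")
  case False
  with assms have x: "0 < x" by simp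
  have "ln (1 / x) \<le> (1 / x) powr (2 - p) / (2 - p)"
    using x assms by (intro ln_powr_bound) auto
  then have "x\<^sup>2 * ln (1 / x) \<le> x\<^sup>2 * ((1 / x) powr (2 - p) / (2 - p))"
    by (intro mult_left_mono) auto
  also have "x\<^sup>2 * ((1 / x) powr (2 - p) / (2 - p)) = 1 / (2 - p) * (x powr 2 * x powr (p - 2))"
    using x by (simp add: powr_divide powr_minus_divide[of x "2 - p", symmetric])
  also have "\<dots> = 1 / (2 - p) * x powr p"
    by (simp flip: powr_add)
  finally show ?thesis using x by (simp add: ln_div)
qed simp

theorem proposition3p8:
  fixes \<Phi> :: "ennreal \<Rightarrow> ennreal" and g :: "int ^ 'n \<Rightarrow> complex" and c p :: real
  assumes "young_function \<Phi>"
    and "0 < c" and "c \<le> exp (- 2 / 3)"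
    and "\<And>x::real. 0 \<le> x \<Longrightarrow> x \<le> c \<Longrightarrow> \<Phi> (ennreal x) = ennreal (- (x\<^sup>2 * ln x))"
    and "g \<in> schwartz" and "g \<noteq> (\<lambda>k. 0)"
    and "1 \<le> p" and "p < 2"
  shows "modulation_space (Lp_norm p) g \<subseteq> modulation_space (orlicz_norm \<Phi>) g \<and>
    modulation_space (orlicz_norm \<Phi>) g \<subseteq> modulation_space (Lp_norm 2) g \<and>
    continuous_dense_inclusion
      (modulation_topology (Lp_norm p) g) (modulation_topology (orlicz_norm \<Phi>) g) \<and>
    continuous_dense_inclusion
      (modulation_topology (orlicz_norm \<Phi>) g) (modulation_topology (Lp_norm 2) g)"
proof -
  note \<Phi>_eq = assms(4)
  obtain k0 where g: "g \<in> schwartz" "g k0 \<noteq> 0"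
    using assms(5,6) by fastforce
  have \<Phi>: "modular \<Phi>"
    by (rule young_function_modular[OF assms(1,2)]) (use assms(2) in \<open>simp add: \<Phi>_eq\<close>)
  \<comment> \<open>\<open>c / 2\<close> makes the formula for \<Phi> available at both
    \<open>x\<close> and \<open>2 * x\<close>; \<open>exp (- 1)\<close> gives
    \<open>- ln x \<ge> 1\<close>, hence \<open>x^2 <= \<Phi> x\<close>.\<close>
  define x0 where "x0 = min (c / 2) (exp (- 1))"
  have "0 < x0" using assms(2) by (simp add: x0_def)
  have x0: "x \<le> c" "2 * x \<le> c" "x \<le> exp (- 1)" "x < 1" if "0 \<le> x" "x \<le> x0" for x
  proof -
    show "2 * x \<le> c" "x \<le> c" "x \<le> exp (- 1)"
      using that assms(2) by (auto simp: x0_def)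
    then show "x < 1"
      using exp_less_one_iff[of "-1::real"] by linarith
  qed
  have le1: "\<Phi> (ennreal x) \<le> ennreal (1 / (2 - p)) * power_modular p (ennreal x)" if "0 \<le> x" "x \<le> x0" for x
    using that x0[OF that] square_log_le_powr[of x p] assms(8)
    by (simp add: \<Phi>_eq ennreal_leI flip: ennreal_mult)
  have le2: "power_modular 2 (ennreal x) \<le> ennreal 1 * \<Phi> (ennreal x)" if x: "0 \<le> x" "x \<le> x0" for x
  proof (cases "x = 0")
    case False
    then have "0 < x" using x by simp
    have "ln x \<le> ln (exp (- 1))"
      using \<open>0 < x\<close> x0(3)[OF x] by (subst ln_le_cancel_iff) auto
    then have "x\<^sup>2 * 1 \<le> x\<^sup>2 * (- ln x)"
      by (intro mult_left_mono) auto
    then show ?thesis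
      using x x0[OF x] by (simp add: \<Phi>_eq ennreal_leI)
  qed (simp add: power_modular_def)
  have doubling1: "\<Phi> (ennreal (2 * x)) \<le> ennreal 4 * \<Phi> (ennreal x)" if x: "0 \<le> x" "x \<le> x0" for x
  proof (cases "x = 0")
    case False
    then have "0 < x" using x by simp
    \<comment> \<open>Doubling decreases \<open>- ln\<close>, so the logarithm can only help, and
      the constant 4 is that of the square.\<close>
    then have "(2 * x)\<^sup>2 * ln x \<le> (2 * x)\<^sup>2 * ln (2 * x)"
      by (intro mult_left_mono) auto
    then have "ennreal (- ((2 * x)\<^sup>2 * ln (2 * x))) \<le> ennreal (4 * - (x\<^sup>2 * ln x))"
      by (intro ennreal_leI) (simp add: power_mult_distrib)
    also have "\<dots> = ennreal 4 * ennreal (- (x\<^sup>2 * ln x))"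
      by (rule ennreal_mult') simp
    finally show ?thesis
      using x x0[OF x] by (simp only: \<Phi>_eq)
  qed (simp add: modular_0[OF \<Phi>])
  have doubling2: "power_modular 2 (ennreal (2 * x)) \<le> ennreal 4 * power_modular 2 (ennreal x)"
    if "0 \<le> x" "x \<le> x0" for x
  proof -
    have "power_modular 2 (ennreal (2 * x)) = ennreal (4 * x powr 2)"
      using that by (simp add: power_mult_distrib)
    also have "\<dots> = ennreal 4 * ennreal (x powr 2)"
      by (rule ennreal_mult') simp
    finally show ?thesis using that by (simp del: powr_numeral)
  qed
  have pos1: "0 < \<Phi> (ennreal x)" if "0 < x" for x
  proof -
    \<comment> \<open>Beyond \<open>c\<close> no formula for \<Phi> is given, so positivity at
      \<open>x\<close> is inherited by monotonicity from a point \<open>z < 1\<close> where the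
      formula applies.\<close>
    define z where "z = min x x0"
    have z: "0 < z" "z \<le> x" "z \<le> x0"
      using that \<open>0 < x0\<close> by (simp_all add: z_def)
    then have "z \<le> c" "z < 1"
      using x0[of z] by auto
    then have "z\<^sup>2 * ln z < 0"
      using z(1) by (intro mult_pos_neg) auto
    then have "0 < ennreal (- (z\<^sup>2 * ln z))"
      by simp
    also have "\<dots> = \<Phi> (ennreal z)"
      using z(1) \<open>z \<le> c\<close> by (intro \<Phi>_eq[symmetric]) auto
    also have "\<dots> \<le> \<Phi> (ennreal x)"
      using z by (intro modular_mono[OF \<Phi>]) auto
    finally show ?thesis .
  qed
  have pos2: "0 < power_modular 2 (ennreal x)" if "0 < x" for x
    using that by simp
  have Lp: "modular (power_modular p)" "modular (power_modular 2)"
    using assms(7) by (simp_all add: modular_power)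
  have "0 < p" using assms(7) by simp
  \<comment> \<open>The explicit \<open>num\<close> term fixes the generic numeral exponent to
    2.\<close>
  note Lp_eq = modulation_Lp_eq_orlicz[OF this g(1)] modulation_Lp_eq_orlicz[OF zero_less_numeral g(1), of "num.Bit0 num.One"]
  have 1: "continuous_dense_inclusion
      (modulation_topology (Lp_norm p) g) (modulation_topology (orlicz_norm \<Phi>) g)"
    unfolding Lp_eq
    by (rule modulation_continuous_dense_inclusion[OF Lp(1) \<Phi> \<open>0 < x0\<close> le1 doubling1 pos1 g])
  have 2: "continuous_dense_inclusion
      (modulation_topology (orlicz_norm \<Phi>) g) (modulation_topology (Lp_norm 2) g)"
    unfolding Lp_eq
    by (rule modulation_continuous_dense_inclusion[OF \<Phi> Lp(2) \<open>0 < x0\<close> le2 doubling2 pos2 g])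
  show ?thesis
    using 1 2 by (auto simp: continuous_dense_inclusion_def modulation_topology_def)
qed

end
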